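(* There exists a randomized online algorithm for edge-weighted online bipartite matching (with free disposal) that is $0.5086$-competitive.
   Context: Edge-weighted online bipartite matching (free disposal model): there is a finite bipartite graph with offline vertex set $L$ and online vertex set $R$, edge set $L\times R$, and nonnegative edge weights $w_{ij}\ge 0$ for $i\in L$, $j\in R$ (missing edges have weight $0$). The set $L$ is known in advance. The vertices of $R$ arrive one at a time, in an order and with weights fixed in advance by an oblivious adversary and unknown to the algorithm. When $j\in R$ arrives, the weights $w_{ij}$, $i\in L$, are revealed, and the algorithm must immediately and irrevocably either match $j$ to one vertex $i\in L$ or leave $j$ unmatched. An offline vertex may be matched any number of times, but only its heaviest matched edge counts: the objective value is $\sum_{i\in L}\max\{w_{ij} : j \text{ was matched to } i\}$ (the maximum over the empty set is $0$). The offline optimum of an instance is the maximum total weight of a matching in the weighted bipartite graph. A randomized online algorithm is $\Gamma$-competitive if, on every instance, its expected objective value is at least $\Gamma$ times the offline optimum. *)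

theory Defs
  imports "HOL-Probability.Probability"
begin

text \<open>
  The online vertices are named by their position in the arrival order, so an instance consists of
  the set \<open>L\<close> of offline vertices, the number \<open>m\<close> of online vertices, and the weights \<open>w i j\<close> of the
  edges \<open>(i, j)\<close> of \<open>L \<times> {..<m}\<close>. Ranging over all \<open>w\<close> covers every arrival order.
\<close>

definition obm_instance :: "'l set \<Rightarrow> nat \<Rightarrow> ('l \<Rightarrow> nat \<Rightarrow> real) \<Rightarrow> bool" where
  "obm_instance L m w \<longleftrightarrow> finite L \<and> (\<forall>i\<in>L. \<forall>j<m. 0 \<le> w i j)"

definition bipartite_matching :: "'l set \<Rightarrow> nat \<Rightarrow> ('l \<times> nat) set \<Rightarrow> bool" where
  "bipartite_matching L m M \<longleftrightarrow> M \<subseteq> L \<times> {..<m} \<and>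
     (\<forall>e\<in>M. \<forall>f\<in>M. e \<noteq> f \<longrightarrow> fst e \<noteq> fst f \<and> snd e \<noteq> snd f)"

definition offline_opt :: "'l set \<Rightarrow> nat \<Rightarrow> ('l \<Rightarrow> nat \<Rightarrow> real) \<Rightarrow> real" where
  "offline_opt L m w = Max ((\<lambda>M. \<Sum>(i, j)\<in>M. w i j) ` {M. bipartite_matching L m M})"

text \<open>
  On each arrival the algorithm is given \<open>L\<close>, the list of the weight vectors revealed so far (the
  last one belongs to the arriving vertex), and the list of its own earlier outcomes; it is given
  neither \<open>m\<close> nor any later weights. It then draws an outcome \<open>(r, d)\<close>. The decision \<open>d\<close> is \<open>Some i\<close>
  to match the arriving vertex to \<open>i\<close>, and \<open>None\<close> to leave it unmatched. The number \<open>r\<close> has no effect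
  on the matching: it is private memory, which makes internal random choices available to later
  steps (correlated decisions, as from a random seed shared by all steps).
\<close>

type_synonym 'l outcome = "nat \<times> 'l option"

type_synonym 'l online_alg =
  "'l set \<Rightarrow> ('l \<Rightarrow> real) list \<Rightarrow> 'l outcome list \<Rightarrow> 'l outcome pmf"

definition valid_online_alg :: "'l online_alg \<Rightarrow> bool" where
  "valid_online_alg A \<longleftrightarrow>
     (\<forall>L ws h. finite L \<longrightarrow> (\<forall>(r, d)\<in>set_pmf (A L ws h). d \<in> insert None (Some ` L)))"

definition revealed :: "'l set \<Rightarrow> ('l \<Rightarrow> nat \<Rightarrow> real) \<Rightarrow> nat \<Rightarrow> 'l \<Rightarrow> real" where
  "revealed L w j = (\<lambda>i. if i \<in> L then w i j else 0)"

primrec run :: "'l online_alg \<Rightarrow> 'l set \<Rightarrow> ('l \<Rightarrow> nat \<Rightarrow> real) \<Rightarrow> nat \<Rightarrow> 'l outcome list pmf" where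
  "run A L w 0 = return_pmf []"
| "run A L w (Suc j) =
     bind_pmf (run A L w j) (\<lambda>h.
       map_pmf (\<lambda>x. h @ [x]) (A L (map (revealed L w) [0..<Suc j]) h))"

text \<open>
  Free disposal. Weights on \<open>L\<close> being nonnegative, inserting \<open>0\<close> only fixes the maximum over the
  empty set.
\<close>

definition objective ::
  "'l set \<Rightarrow> nat \<Rightarrow> ('l \<Rightarrow> nat \<Rightarrow> real) \<Rightarrow> 'l outcome list \<Rightarrow> real" where
  "objective L m w h = (\<Sum>i\<in>L. Max (insert 0 (w i ` {j. j < m \<and> snd (h ! j) = Some i})))"

definition competitive :: "real \<Rightarrow> 'l online_alg \<Rightarrow> bool" where
  "competitive \<Gamma> A \<longleftrightarrow>
     (\<forall>L m w. obm_instance L m w \<longrightarrow>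
        measure_pmf.expectation (run A L w m) (objective L m w) \<ge> \<Gamma> * offline_opt L m w)"

end

theory Submission
  imports Defs
begin

text \<open>
  In each round the algorithm deterministically fills ten slots with offline vertices (or \<open>None\<close>) and then
  draws two slots independently, with contents \<open>a\<close> and \<open>b\<close>. If \<open>a = b\<close> this is the decision. Otherwise
  a coin decides between \<open>a\<close> and \<open>b\<close>: the rounds with first draw \<open>a \<noteq> b\<close> alternate, for every fixed \<open>a\<close>, between
  sender rounds, which flip a fresh coin, and receiver rounds, which use the opposite of the coin of
  the preceding sender round of \<open>a\<close>. One random bit fixes the initial role. Each coin is read at most
  twice, both times with the same \<open>a\<close> and in opposite ways, so a vertex that occurs in both rounds is
  selected in one of them. Given the slot draws, the coins are independent; averaging over the
  draws gives, for each offline vertex and each weight threshold, a linear recursion on three numbers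
  whose sum bounds the probability that no edge above the threshold is matched.

  The slots are filled greedily with respect to the decrease of a linear potential of these states,
  integrated over all thresholds. A dual variable \<open>\<alpha>\<close> of an offline vertex is the integral of an
  affine function of its final states, and \<open>\<beta>\<close> of a round is its greedy gain. Their sum is a lower bound for the
  expected objective, and concavity of the gain yields \<open>\<alpha> i + \<beta> j \<ge> 0.5086 * w i j\<close>.
\<close>

section \<open>Coupled coins\<close>

text \<open>
  For fixed slot draws, \<open>phase a b e n x\<close> is the role of \<open>x\<close> in the next round with \<open>a = x \<noteq> b\<close>:
  \<open>None\<close> means sender, \<open>Some (Some k)\<close> means receiver partnered with the sender round \<open>k\<close>, and
  \<open>Some None\<close> means receiver without a partner, which happens only before the first such round.
\<close>

primrec phase :: "(nat \<Rightarrow> 'x) \<Rightarrow> (nat \<Rightarrow> 'x) \<Rightarrow> bool \<Rightarrow> nat \<Rightarrow> 'x \<Rightarrow> nat option option" where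
  "phase a b e 0 x = (if e then None else Some None)"
| "phase a b e (Suc n) x =
     (if a n \<noteq> b n \<and> a n = x
      then (case phase a b e n x of None \<Rightarrow> Some (Some n) | Some _ \<Rightarrow> None)
      else phase a b e n x)"

definition coin_src :: "(nat \<Rightarrow> 'x) \<Rightarrow> (nat \<Rightarrow> 'x) \<Rightarrow> bool \<Rightarrow> nat \<Rightarrow> nat" where
  "coin_src a b e n =
     (if a n = b n then n else case phase a b e n (a n) of Some (Some k) \<Rightarrow> k | _ \<Rightarrow> n)"

definition select :: "(nat \<Rightarrow> 'x) \<Rightarrow> (nat \<Rightarrow> 'x) \<Rightarrow> bool \<Rightarrow> (nat \<Rightarrow> bool) \<Rightarrow> nat \<Rightarrow> 'x" where
  "select a b e c n =
     (if (if coin_src a b e n = n then c n else \<not> c (coin_src a b e n)) then a n else b n)"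

text \<open>
  \<open>miss\<close> is the factor by which round \<open>n\<close> decreases the bound on the probability that \<open>x\<close> is never
  selected in the rounds of \<open>J\<close>: it is \<open>0\<close> when both halves of a sender/receiver pair of \<open>x\<close>
  lie in \<open>J\<close>, since then \<open>x\<close> is selected in exactly one of them.
\<close>

definition miss :: "(nat \<Rightarrow> 'x) \<Rightarrow> (nat \<Rightarrow> 'x) \<Rightarrow> bool \<Rightarrow> 'x \<Rightarrow> nat set \<Rightarrow> nat \<Rightarrow> real" where
  "miss a b e x J n =
     (if n \<notin> J then 1
      else if a n = x \<and> b n = x then 0
      else if a n = x then
        (case phase a b e n x of Some (Some k) \<Rightarrow> if k \<in> J then 0 else 1/2 | _ \<Rightarrow> 1/2)
      else if b n = x then 1/2 else 1)"

text \<open>Every round with first draw \<open>x\<close> and a different second draw overwrites the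
  phase of \<open>x\<close>, so a partner is always the latest such round. Disjointness of the
  sender/receiver pairs rests on this.\<close>

lemma phase_partner:
  "phase a b e n x = Some (Some k) \<Longrightarrow>
     k < n \<and> a k = x \<and> a k \<noteq> b k \<and> phase a b e k x = None \<and>
     (\<forall>l. k < l \<and> l < n \<longrightarrow> a l \<noteq> x \<or> b l = x)"
proof (induction n)
  case (Suc n)
  show ?case
  proof (cases "a n \<noteq> b n \<and> a n = x")
    case True
    then have "phase a b e n x = None" "k = n"
      using Suc.prems by (auto split: option.splits)
    with True show ?thesis by auto
  next
    case False
    then have "phase a b e n x = Some (Some k)" using Suc.prems by auto
    with Suc.IH False show ?thesis by (auto simp: less_Suc_eq)
  qed
qed (auto split: if_splits)

lemma coin_src_cases:
  obtains "coin_src a b e n = n" 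
  | "a n \<noteq> b n" "phase a b e n (a n) = Some (Some (coin_src a b e n))"
  unfolding coin_src_def
  by (cases "a n = b n"; cases "phase a b e n (a n)"; cases "the (phase a b e n (a n))") auto

lemma coin_src_le: "coin_src a b e n \<le> n"
  using phase_partner[of a b e n "a n"] by (cases a b e n rule: coin_src_cases) auto

text \<open>A partner was a sender, and a sender reads its own coin.\<close>

lemma coin_src_idem: "coin_src a b e (coin_src a b e n) = coin_src a b e n"
proof (cases a b e n rule: coin_src_cases)
  case 2
  from phase_partner[OF 2(2)] show ?thesis
    unfolding coin_src_def[of a b e "coin_src a b e n"] by auto
qed simp

text \<open>Two receivers with the same partner \<open>k\<close> have the same first draw, so the
  earlier one would be a round of that vertex strictly between \<open>k\<close> and the later one,
  which \<open>phase_partner\<close> excludes.\<close>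

lemma coin_src_inj:
  assumes "coin_src a b e n = k" "coin_src a b e n' = k" "n \<noteq> k" "n' \<noteq> k"
  shows "n = n'"
proof -
  have *: False if "n < n'" and 1: "coin_src a b e n = k" "n \<noteq> k" and 2: "coin_src a b e n' = k" "n' \<noteq> k" for n n'
  proof -
    have p: "a n \<noteq> b n" "phase a b e n (a n) = Some (Some k)"
      using 1 by (cases a b e n rule: coin_src_cases; auto)+
    have p': "phase a b e n' (a n') = Some (Some k)"
      using 2 by (cases a b e n' rule: coin_src_cases; auto)+
    from phase_partner[OF p(2)] phase_partner[OF p'] p(1) \<open>n < n'\<close>
    show False by metis
  qed
  show ?thesis using *[of n n'] *[of n' n] assms by (metis nat_neq_iff)
qed

text \<open>Rounds interact only through shared coins, so avoiding \<open>x\<close> throughout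
  \<open>J\<close> is a product event: each coin \<open>k\<close> must lie in its own set of this
  form.\<close>

definition admissible :: "(nat \<Rightarrow> 'x) \<Rightarrow> (nat \<Rightarrow> 'x) \<Rightarrow> bool \<Rightarrow> 'x \<Rightarrow> nat set \<Rightarrow> nat \<Rightarrow> nat \<Rightarrow> bool set" where
  "admissible a b e x J N k =
     {v. \<forall>n<N. n \<in> J \<and> coin_src a b e n = k \<longrightarrow> (if (if n = k then v else \<not> v) then a n else b n) \<noteq> x}"

lemma prob_coin: "measure_pmf.prob (pmf_of_set (UNIV :: bool set)) A = (if True \<in> A then 1/2 else 0) + (if False \<in> A then 1/2 else 0)"
proof -
  have "A = {} \<or> A = {True} \<or> A = {False} \<or> A = UNIV"
    unfolding set_eq_iff all_bool_eq by auto
  then show ?thesis by (auto simp: measure_pmf_of_set)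
qed

text \<open>A coin is read by no round, by its own round only, or by its own round and one receiver.
  In a pair inside \<open>J\<close> with first draw \<open>x\<close>, either value selects
  \<open>x\<close>. The bound is strict for a pair inside \<open>J\<close> whose second draws are
  both \<open>x\<close>: the opposite readings rule out both values, while the factors are only 1/2
  each.\<close>

lemma prob_admissible:
  assumes "k < N"
  shows "measure_pmf.prob (pmf_of_set UNIV) (admissible a b e x J N k)
         \<le> (\<Prod>n | n < N \<and> coin_src a b e n = k. miss a b e x J n)"
proof (cases "coin_src a b e k = k")
  case False
  then have "{n. n < N \<and> coin_src a b e n = k} = {}" using coin_src_idem by auto
  then have "(\<Prod>n | n < N \<and> coin_src a b e n = k. miss a b e x J n) = 1" by (simp only: prod.empty)
  then show ?thesis by simp
next
  case own: True
  have nopartner: "a k = b k" if "phase a b e k (a k) = Some (Some l)" for l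
    using own that phase_partner[OF that] by (auto simp: coin_src_def)
  have missk: "miss a b e x J k =
    (if k \<notin> J then 1 else if a k = x \<and> b k = x then 0 else if a k = x \<or> b k = x then 1/2 else 1)"
    using nopartner by (cases "phase a b e k (a k)"; cases "the (phase a b e k (a k))") (auto simp: miss_def)
  have Tk: "v \<notin> admissible a b e x J N k" if "k \<in> J" "(if v then a k else b k) = x" for v
    using own assms that by (auto simp: admissible_def)
  have miss1: "measure_pmf.prob (pmf_of_set UNIV) (admissible a b e x J N k) \<le> miss a b e x J k"
    unfolding prob_coin missk using Tk[of True] Tk[of False] by auto
  show ?thesis
  proof (cases "\<exists>n<N. n \<noteq> k \<and> coin_src a b e n = k")
    case False
    then have "{n. n < N \<and> coin_src a b e n = k} = {k}" using own assms by auto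
    then show ?thesis using miss1 by simp
  next
    case True
    then obtain n where n: "n < N" "n \<noteq> k" "coin_src a b e n = k" by auto
    have "{n. n < N \<and> coin_src a b e n = k} = {k, n}"
      using own assms n by (blast intro: coin_src_inj)
    then have *: "(\<Prod>n | n < N \<and> coin_src a b e n = k. miss a b e x J n) = miss a b e x J k * miss a b e x J n"
      using n by simp
    have p: "a n \<noteq> b n" "phase a b e n (a n) = Some (Some k)"
      using n by (cases a b e n rule: coin_src_cases; auto)+
    have q: "a k = a n" "a k \<noteq> b k" using phase_partner[OF p(2)] by blast+
    have missn: "miss a b e x J n =
      (if n \<notin> J then 1 else if a n = x then (if k \<in> J then 0 else 1/2) else if b n = x then 1/2 else 1)"
      using p by (auto simp: miss_def)
    have Tn: "v \<notin> admissible a b e x J N k" if "n \<in> J" "(if v then b n else a n) = x" for v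
    proof
      assume "v \<in> admissible a b e x J N k"
      then have "(if (if n = k then v else \<not> v) then a n else b n) \<noteq> x"
        using n that(1) unfolding admissible_def by blast
      then show False using n(2) that(2) by (cases v) simp_all
    qed
    show ?thesis
      using p(1) q(2) Tk[of True] Tk[of False] Tn[of True] Tn[of False]
      unfolding * prob_coin missk missn q(1)
      by (cases "n \<in> J"; cases "k \<in> J"; cases "a n = x"; cases "b n = x"; cases "b k = x") simp_all
  qed
qed

lemma prob_never_selected:
  "measure_pmf.prob (Pi_pmf {..<N} d (\<lambda>_. pmf_of_set UNIV)) {c. \<forall>n<N. n \<in> J \<longrightarrow> select a b e c n \<noteq> x}
     \<le> (\<Prod>n<N. miss a b e x J n)"
proof -
  let ?src = "coin_src a b e"
  have "{c. \<forall>n<N. n \<in> J \<longrightarrow> select a b e c n \<noteq> x} = Pi {..<N} (admissible a b e x J N)"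
  proof (rule set_eqI)
    fix c
    have sel: "select a b e c n = (if (if n = ?src n then c (?src n) else \<not> c (?src n)) then a n else b n)" for n
      by (cases "?src n = n") (auto simp: select_def)
    have "c \<in> Pi {..<N} (admissible a b e x J N) \<longleftrightarrow> (\<forall>n<N. ?src n < N \<and> n \<in> J \<longrightarrow> select a b e c n \<noteq> x)"
      unfolding sel admissible_def Pi_def by blast
    then show "c \<in> {c. \<forall>n<N. n \<in> J \<longrightarrow> select a b e c n \<noteq> x} \<longleftrightarrow> c \<in> Pi {..<N} (admissible a b e x J N)"
      using le_less_trans[OF coin_src_le[of a b e]] by blast
  qed
  then have "measure_pmf.prob (Pi_pmf {..<N} d (\<lambda>_. pmf_of_set UNIV)) {c. \<forall>n<N. n \<in> J \<longrightarrow> select a b e c n \<noteq> x}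
      = (\<Prod>k<N. measure_pmf.prob (pmf_of_set UNIV) (admissible a b e x J N k))"
    by (simp add: measure_Pi_pmf_Pi)
  \<comment> \<open>The factors of the rounds are grouped by the coin that they read.\<close>
  also have "\<dots> \<le> (\<Prod>k<N. \<Prod>n | n \<in> {..<N} \<and> ?src n = k. miss a b e x J n)"
    using prob_admissible[of _ N a b e x J] by (intro prod_mono) auto
  also have "\<dots> = (\<Prod>n<N. miss a b e x J n)"
    using le_less_trans[OF coin_src_le[of a b e]] by (intro prod.group) auto
  finally show ?thesis .
qed

section \<open>Causality of the coupling\<close>

lemma phase_cong:
  "(\<And>k. k < n \<Longrightarrow> a k = a' k) \<Longrightarrow> (\<And>k. k < n \<Longrightarrow> b k = b' k) \<Longrightarrow> phase a b e n x = phase a' b' e n x"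
  by (induction n) auto

lemma coin_src_cong:
  assumes "\<And>k. k \<le> n \<Longrightarrow> a k = a' k" "\<And>k. k \<le> n \<Longrightarrow> b k = b' k"
  shows "coin_src a b e n = coin_src a' b' e n"
  unfolding coin_src_def using assms phase_cong[of n a a' b b'] by simp

text \<open>A round never reads a later coin (\<open>coin_src_le\<close>), so the selection can be
  carried out online.\<close>

lemma select_cong:
  assumes "\<And>k. k \<le> n \<Longrightarrow> a k = a' k" "\<And>k. k \<le> n \<Longrightarrow> b k = b' k" "\<And>k. k \<le> n \<Longrightarrow> c k = c' k"
  shows "select a b e c n = select a' b' e c' n"
  unfolding select_def using assms coin_src_cong[of n a a' b b'] coin_src_le[of a' b' e n] by simp

lemma miss_cong:
  assumes "\<And>k. k \<le> n \<Longrightarrow> a k = a' k" "\<And>k. k \<le> n \<Longrightarrow> b k = b' k"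
  shows "miss a b e x J n = miss a' b' e x J n"
  unfolding miss_def using assms phase_cong[of n a a' b b'] by simp

section \<open>Averaging over the slot draws\<close>

type_synonym state = "real \<times> real \<times> real"

text \<open>
  A state \<open>(u, v, z)\<close> of an offline vertex \<open>i\<close> and a threshold \<open>t\<close> splits the (bound on the) probability
  that no edge of weight \<open>\<ge> t\<close> has been matched to \<open>i\<close> according to the next role of \<open>i\<close>: sender (\<open>u\<close>),
  receiver whose partner round had weight \<open>\<ge> t\<close> (\<open>v\<close>), any other receiver (\<open>z\<close>). If \<open>i\<close> occupies a
  fraction \<open>y\<close> of the slots, \<open>touch y\<close> is the transition in a round of weight \<open>\<ge> t\<close>, and \<open>skip y\<close> the one
  in a round of smaller weight.
\<close>

fun touch :: "real \<Rightarrow> state \<Rightarrow> state" where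
  "touch y (u, v, z) =
     (let p = (1 - y) * (1 - y/2); r = y * (1 - y) / 2 in (p * u + r * z, p * v + r * u, p * z))"

fun skip :: "real \<Rightarrow> state \<Rightarrow> state" where
  "skip y (u, v, z) = (let s = y * (1 - y) in (u + s * (v + z - u), v - s * v, z + s * (u - z)))"

fun mass :: "state \<Rightarrow> real" where
  "mass (u, v, z) = u + v + z"

primrec evolve :: "(nat \<Rightarrow> real) \<Rightarrow> nat set \<Rightarrow> state \<Rightarrow> nat \<Rightarrow> state" where
  "evolve y J q 0 = q"
| "evolve y J q (Suc n) = (if n \<in> J then touch (y n) (evolve y J q n) else skip (y n) (evolve y J q n))"

section \<open>Independent draws and their expectations\<close>

lemma expectation_pair_pmf:
  fixes F :: "_ \<Rightarrow> real"
  assumes "finite (set_pmf p)" "finite (set_pmf q)"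
  shows "measure_pmf.expectation (pair_pmf p q) F
       = measure_pmf.expectation p (\<lambda>x. measure_pmf.expectation q (\<lambda>y. F (x, y)))"
proof -
  have "measure_pmf.expectation (pair_pmf p q) F = (\<Sum>z\<in>set_pmf p \<times> set_pmf q. F z * pmf (pair_pmf p q) z)"
    using assms by (intro integral_measure_pmf_real) auto
  also have "\<dots> = (\<Sum>x\<in>set_pmf p. \<Sum>y\<in>set_pmf q. F (x, y) * pmf q y * pmf p x)"
    by (subst sum.cartesian_product) (auto intro!: sum.cong simp: pmf_pair)
  also have "\<dots> = (\<Sum>x\<in>set_pmf p. measure_pmf.expectation q (\<lambda>y. F (x, y)) * pmf p x)"
    using assms by (intro sum.cong refl) (simp add: integral_measure_pmf_real[where A = "set_pmf q"] sum_distrib_right)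
  also have "\<dots> = measure_pmf.expectation p (\<lambda>x. measure_pmf.expectation q (\<lambda>y. F (x, y)))"
    using assms by (intro integral_measure_pmf_real[symmetric]) auto
  finally show ?thesis .
qed

lemma finite_set_Pi_pmf:
  assumes "finite A" "\<And>x. x \<in> A \<Longrightarrow> finite (set_pmf (p x))"
  shows "finite (set_pmf (Pi_pmf A d p))"
  using assms by (auto simp: set_Pi_pmf)

lemma expectation_Pi_pmf_Suc:
  fixes F :: "_ \<Rightarrow> real"
  assumes "finite (set_pmf p)"
  shows "measure_pmf.expectation (Pi_pmf {..<Suc n} d (\<lambda>_. p)) F
       = measure_pmf.expectation (Pi_pmf {..<n} d (\<lambda>_. p)) (\<lambda>f. measure_pmf.expectation p (\<lambda>z. F (f(n := z))))"
proof -
  have "measure_pmf.expectation (Pi_pmf {..<Suc n} d (\<lambda>_. p)) F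
      = measure_pmf.expectation (pair_pmf (Pi_pmf {..<n} d (\<lambda>_. p)) p) (\<lambda>(f, z). F (f(n := z)))"
    unfolding lessThan_Suc by (subst Pi_pmf_insert) (auto simp: case_prod_unfold pair_commute_pmf[of p])
  also have "\<dots> = measure_pmf.expectation (Pi_pmf {..<n} d (\<lambda>_. p)) (\<lambda>f. measure_pmf.expectation p (\<lambda>z. F (f(n := z))))"
    using assms by (subst expectation_pair_pmf) (auto intro!: finite_set_Pi_pmf)
  finally show ?thesis .
qed

text \<open>Splits a sequence of independent seeds into independent sequences of their components,
  so that coins can be averaged first, with the slot draws fixed.\<close>

lemma Pi_pmf_pair:
  "Pi_pmf {..<n::nat} (d, d') (\<lambda>_. pair_pmf p q)
   = map_pmf (\<lambda>(f, g) j. (f j, g j)) (pair_pmf (Pi_pmf {..<n} d (\<lambda>_. p)) (Pi_pmf {..<n} d' (\<lambda>_. q)))"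
proof (induction n)
  case (Suc n)
  have upd: "(\<lambda>j. (f j, g j))(n := (x, y)) = (\<lambda>j. ((f(n := x)) j, (g(n := y)) j))" for f g x y
    by (auto simp: fun_eq_iff)
  let ?P = "Pi_pmf {..<n} d (\<lambda>_. p)" and ?Q = "Pi_pmf {..<n} d' (\<lambda>_. q)"
  have "Pi_pmf {..<Suc n} (d, d') (\<lambda>_. pair_pmf p q)
    = bind_pmf p (\<lambda>x. bind_pmf q (\<lambda>y. bind_pmf ?P (\<lambda>f. bind_pmf ?Q (\<lambda>g.
        return_pmf (\<lambda>j. ((f(n := x)) j, (g(n := y)) j))))))"
    by (simp only: lessThan_Suc Pi_pmf_insert' finite_lessThan lessThan_iff less_irrefl not_False_eq_True Suc)
       (simp add: pair_pmf_def map_pmf_def bind_assoc_pmf bind_return_pmf upd del: fun_upd_apply)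
  also have "\<dots> = bind_pmf p (\<lambda>x. bind_pmf ?P (\<lambda>f. bind_pmf q (\<lambda>y. bind_pmf ?Q (\<lambda>g.
        return_pmf (\<lambda>j. ((f(n := x)) j, (g(n := y)) j))))))"
    by (subst bind_commute_pmf[of q ?P]) simp
  also have "\<dots> = map_pmf (\<lambda>(f, g) j. (f j, g j)) (pair_pmf (Pi_pmf {..<Suc n} d (\<lambda>_. p)) (Pi_pmf {..<Suc n} d' (\<lambda>_. q)))"
    unfolding lessThan_Suc
    by (simp add: Pi_pmf_insert' pair_pmf_def map_pmf_def bind_assoc_pmf bind_return_pmf del: fun_upd_apply)
  finally show ?case .
qed simp

abbreviation slot_pmf :: "nat pmf" where "slot_pmf \<equiv> pmf_of_set {..<10}"
abbreviation coin_pmf :: "bool pmf" where "coin_pmf \<equiv> pmf_of_set UNIV"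

lemma finite_slot_pmf [simp]: "finite (set_pmf slot_pmf)"
  by (subst set_pmf_of_set) (auto simp: lessThan_empty_iff)

definition share :: "(nat \<Rightarrow> 'x) \<Rightarrow> 'x \<Rightarrow> real" where
  "share \<sigma> x = card {s. s < 10 \<and> \<sigma> s = x} / 10"

lemma expectation_slot:
  "measure_pmf.expectation slot_pmf (\<lambda>s. g (\<sigma> s = x)) = share \<sigma> x * g True + (1 - share \<sigma> x) * g False"
proof -
  have "(\<Sum>s<10. g (\<sigma> s = x)) = (\<Sum>s<10. g False + (if \<sigma> s = x then g True - g False else 0))"
    by (intro sum.cong) simp_all
  also have "\<dots> = 10 * g False + (\<Sum>s | s \<in> {..<10} \<and> \<sigma> s = x. g True - g False)"
    unfolding sum.distrib by (subst sum.inter_filter) simp_all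
  also have "\<dots> = 10 * (share \<sigma> x * g True + (1 - share \<sigma> x) * g False)"
    by (simp add: share_def algebra_simps)
  moreover have "measure_pmf.expectation slot_pmf (\<lambda>s. g (\<sigma> s = x)) = (\<Sum>s<10. g (\<sigma> s = x)) / 10"
    by (subst integral_pmf_of_set) (auto simp: lessThan_empty_iff)
  ultimately show ?thesis by simp
qed

lemma expectation_two_slots:
  "measure_pmf.expectation (pair_pmf slot_pmf slot_pmf) (\<lambda>z. g (\<sigma> (fst z) = x) (\<sigma> (snd z) = x))
   = (let y = share \<sigma> x in
       y * y * g True True + y * (1 - y) * (g True False + g False True) + (1 - y) * (1 - y) * g False False)"
proof -
  have "measure_pmf.expectation (pair_pmf slot_pmf slot_pmf) (\<lambda>z. g (\<sigma> (fst z) = x) (\<sigma> (snd z) = x))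
    = measure_pmf.expectation slot_pmf (\<lambda>s. measure_pmf.expectation slot_pmf (\<lambda>t. g (\<sigma> s = x) (\<sigma> t = x)))"
    by (subst expectation_pair_pmf) auto
  also have "\<dots> = measure_pmf.expectation slot_pmf
      (\<lambda>s. share \<sigma> x * g (\<sigma> s = x) True + (1 - share \<sigma> x) * g (\<sigma> s = x) False)"
    by (simp only: expectation_slot)
  also have "\<dots> = share \<sigma> x * (share \<sigma> x * g True True + (1 - share \<sigma> x) * g True False)
      + (1 - share \<sigma> x) * (share \<sigma> x * g False True + (1 - share \<sigma> x) * g False False)"
    by (rule expectation_slot)
  finally show ?thesis
    by (simp add: Let_def algebra_simps)
qed

definition fstslot :: "(nat \<Rightarrow> nat \<Rightarrow> 'x) \<Rightarrow> (nat \<Rightarrow> nat \<times> nat) \<Rightarrow> nat \<Rightarrow> 'x" where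
  "fstslot \<sigma> \<theta> n = \<sigma> n (fst (\<theta> n))"
definition sndslot :: "(nat \<Rightarrow> nat \<Rightarrow> 'x) \<Rightarrow> (nat \<Rightarrow> nat \<times> nat) \<Rightarrow> nat \<Rightarrow> 'x" where
  "sndslot \<sigma> \<theta> n = \<sigma> n (snd (\<theta> n))"

text \<open>The codes 0, 1, 2 stand for the components \<open>u\<close>, \<open>v\<close>,
  \<open>z\<close> of a state.\<close>

definition kind :: "nat set \<Rightarrow> nat option option \<Rightarrow> nat" where
  "kind J ph = (case ph of None \<Rightarrow> 0 | Some None \<Rightarrow> 2 | Some (Some k) \<Rightarrow> if k \<in> J then 1 else 2)"

definition weight :: "(nat \<Rightarrow> nat \<Rightarrow> 'x) \<Rightarrow> bool \<Rightarrow> 'x \<Rightarrow> nat set \<Rightarrow> nat \<Rightarrow> nat \<Rightarrow> (nat \<Rightarrow> nat \<times> nat) \<Rightarrow> real" where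
  "weight \<sigma> e x J s n \<theta> =
     (if kind J (phase (fstslot \<sigma> \<theta>) (sndslot \<sigma> \<theta>) e n x) = s
      then \<Prod>k<n. miss (fstslot \<sigma> \<theta>) (sndslot \<sigma> \<theta>) e x J k else 0)"

lemma kind_le: "kind J ph < 3"
  by (auto simp: kind_def split: option.splits)

text \<open>The next factor of \<open>miss\<close> and the next role depend on the past draws only
  through \<open>kind\<close>; hence the product of the factors, split by \<open>kind\<close>,
  satisfies a closed recursion.\<close>

lemma weight_Suc:
  fixes \<sigma> :: "nat \<Rightarrow> nat \<Rightarrow> 'x" and z :: "nat \<times> nat" and x :: 'x and n :: nat
    and e :: bool and J :: "nat set" and \<theta> :: "nat \<Rightarrow> nat \<times> nat"
  defines "A \<equiv> \<sigma> n (fst z) = x" and "B \<equiv> \<sigma> n (snd z) = x"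
  defines "W \<equiv> \<lambda>s. weight \<sigma> e x J s n \<theta>"
  shows "weight \<sigma> e x J 0 (Suc n) (\<theta>(n := z)) =
          (if n \<in> J then (if A then (if B then 0 else W 2 / 2) else if B then W 0 / 2 else W 0)
           else if A \<and> \<not> B then W 1 + W 2 else W 0)" (is ?t0)
    and "weight \<sigma> e x J 1 (Suc n) (\<theta>(n := z)) =
          (if n \<in> J then (if A then (if B then 0 else W 0 / 2) else if B then W 1 / 2 else W 1)
           else if A \<and> \<not> B then 0 else W 1)" (is ?t1)
    and "weight \<sigma> e x J 2 (Suc n) (\<theta>(n := z)) =
          (if n \<in> J then (if A then 0 else if B then W 2 / 2 else W 2)
           else if A \<and> \<not> B then W 0 else W 2)" (is ?t2)
proof -
  let ?a = "fstslot \<sigma> (\<theta>(n := z))" and ?b = "sndslot \<sigma> (\<theta>(n := z))"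
  let ?a' = "fstslot \<sigma> \<theta>" and ?b' = "sndslot \<sigma> \<theta>"
  have ab: "k < n \<Longrightarrow> ?a k = ?a' k" "k < n \<Longrightarrow> ?b k = ?b' k" for k
    by (auto simp: fstslot_def sndslot_def)
  have [simp]: "(?a n = x) = A" "(?b n = x) = B" "A \<Longrightarrow> (?a n = ?b n) = B"
    by (auto simp: A_def B_def fstslot_def sndslot_def)
  have ph: "phase ?a ?b e n x = phase ?a' ?b' e n x"
    using ab by (intro phase_cong) auto
  have mi: "(\<Prod>k<n. miss ?a ?b e x J k) = (\<Prod>k<n. miss ?a' ?b' e x J k)"
    using ab by (intro prod.cong refl miss_cong) auto
  have phS: "phase ?a ?b e (Suc n) x = (if A \<and> \<not> B then (case phase ?a' ?b' e n x of None \<Rightarrow> Some (Some n) | Some _ \<Rightarrow> None)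
      else phase ?a' ?b' e n x)"
    by (auto simp: ph)
  have mS: "miss ?a ?b e x J n = 
     (if n \<notin> J then 1 else if A \<and> B then 0 else if A then (if kind J (phase ?a' ?b' e n x) = 1 then 0 else 1/2) else if B then 1/2 else 1)"
    by (auto simp: miss_def ph kind_def split: option.splits)
  have W: "W s = (if kind J (phase ?a' ?b' e n x) = s then \<Prod>k<n. miss ?a' ?b' e x J k else 0)" for s
    by (simp add: W_def weight_def)
  show ?t0 ?t1 ?t2
    unfolding weight_def phS W prod.lessThan_Suc mi mS
    by (auto simp: kind_def split: option.splits)
qed

lemma share_bounds: "0 \<le> share \<sigma> x" "share \<sigma> x \<le> 1"
  using card_mono[of "{..<10}" "{s. s < 10 \<and> \<sigma> s = x}"] by (auto simp: share_def)

lemma expectation_weight: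
  fixes \<sigma> :: "nat \<Rightarrow> nat \<Rightarrow> 'x" and x :: 'x and e :: bool and J :: "nat set" and d :: "nat \<times> nat"
  defines "E \<equiv> \<lambda>s n. measure_pmf.expectation (Pi_pmf {..<n} d (\<lambda>_. pair_pmf slot_pmf slot_pmf)) (weight \<sigma> e x J s n)"
  shows "(E 0 n, E 1 n, E 2 n) = evolve (\<lambda>n. share (\<sigma> n) x) J (if e then (1, 0, 0) else (0, 0, 1)) n"
proof (induction n)
  case 0
  show ?case by (auto simp: E_def weight_def kind_def)
next
  case (Suc n)
  let ?P = "Pi_pmf {..<n} d (\<lambda>_. pair_pmf slot_pmf slot_pmf)" and ?y = "share (\<sigma> n) x"
  have fin: "integrable ?P F" for F :: "_ \<Rightarrow> real"
    by (intro integrable_measure_pmf_finite finite_set_Pi_pmf) auto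
  let ?W = "\<lambda>s. weight \<sigma> e x J s n"
  have ES: "E s (Suc n) = measure_pmf.expectation ?P (\<lambda>\<theta>. measure_pmf.expectation (pair_pmf slot_pmf slot_pmf)
         (\<lambda>z. weight \<sigma> e x J s (Suc n) (\<theta>(n := z))))" for s
    unfolding E_def by (intro expectation_Pi_pmf_Suc) auto
  have lin: "measure_pmf.expectation ?P (\<lambda>\<theta>. c * ?W s \<theta> + c' * ?W s' \<theta>  + c'' * ?W s'' \<theta>) = c * E s n + c' * E s' n + c'' * E s'' n"
    for c c' c'' s s' s'' unfolding E_def by (simp add: fin)
  have two: "measure_pmf.expectation (pair_pmf slot_pmf slot_pmf) (\<lambda>z. g (\<sigma> n (fst z) = x) (\<sigma> n (snd z) = x))
   = ?y * ?y * g True True + ?y * (1 - ?y) * (g True False + g False True) + (1 - ?y) * (1 - ?y) * g False False" for g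
    using expectation_two_slots[of g "\<sigma> n" x] by (simp add: Let_def)
  \<comment> \<open>\<open>?p\<close>: the first draw is not \<open>x\<close>, with factor 1/2 if
    the second one is. \<open>?r\<close>: only the first draw is \<open>x\<close>, times the coin
    factor 1/2. \<open>?s\<close>: the probability of a change of role.\<close>
  let ?p = "(1 - ?y) * (1 - ?y/2)" and ?r = "?y * (1 - ?y) / 2" and ?s = "?y * (1 - ?y)"
  show ?case
  proof (cases "n \<in> J")
    case True
    have E0: "measure_pmf.expectation (pair_pmf slot_pmf slot_pmf) (\<lambda>z. weight \<sigma> e x J 0 (Suc n) (\<theta>(n := z)))
        = ?p * ?W 0 \<theta> + 0 * ?W 1 \<theta> + ?r * ?W 2 \<theta>" for \<theta>
      unfolding weight_Suc if_P[OF True] two[of "\<lambda>A B. if A then (if B then 0 else ?W 2 \<theta> / 2) else if B then ?W 0 \<theta> / 2 else ?W 0 \<theta>"]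
      by (simp add: field_simps)
    have E1: "measure_pmf.expectation (pair_pmf slot_pmf slot_pmf) (\<lambda>z. weight \<sigma> e x J 1 (Suc n) (\<theta>(n := z)))
        = ?r * ?W 0 \<theta> + ?p * ?W 1 \<theta> + 0 * ?W 2 \<theta>" for \<theta>
      unfolding weight_Suc if_P[OF True] two[of "\<lambda>A B. if A then (if B then 0 else ?W 0 \<theta> / 2) else if B then ?W 1 \<theta> / 2 else ?W 1 \<theta>"]
      by (simp add: field_simps)
    have E2: "measure_pmf.expectation (pair_pmf slot_pmf slot_pmf) (\<lambda>z. weight \<sigma> e x J 2 (Suc n) (\<theta>(n := z)))
        = 0 * ?W 0 \<theta> + 0 * ?W 1 \<theta> + ?p * ?W 2 \<theta>" for \<theta>
      unfolding weight_Suc if_P[OF True] two[of "\<lambda>A B. if A then 0 else if B then ?W 2 \<theta> / 2 else ?W 2 \<theta>"]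
      by (simp add: field_simps)
    have S0: "E 0 (Suc n) = ?p * E 0 n + 0 * E 1 n + ?r * E 2 n"
      unfolding ES E0 by (rule lin)
    have S1: "E 1 (Suc n) = ?r * E 0 n + ?p * E 1 n + 0 * E 2 n"
      unfolding ES E1 by (rule lin)
    have S2: "E 2 (Suc n) = 0 * E 0 n + 0 * E 1 n + ?p * E 2 n"
      unfolding ES E2 by (rule lin)
    show ?thesis
      using True unfolding evolve.simps Suc[symmetric] S0 S1 S2 by (simp add: Let_def algebra_simps)
  next
    case False
    have E0: "measure_pmf.expectation (pair_pmf slot_pmf slot_pmf) (\<lambda>z. weight \<sigma> e x J 0 (Suc n) (\<theta>(n := z)))
        = (1 - ?s) * ?W 0 \<theta> + ?s * ?W 1 \<theta> + ?s * ?W 2 \<theta>" for \<theta>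
      unfolding weight_Suc if_not_P[OF False] two[of "\<lambda>A B. if A \<and> \<not> B then ?W 1 \<theta> + ?W 2 \<theta> else ?W 0 \<theta>"]
      by (simp add: field_simps)
    have E1: "measure_pmf.expectation (pair_pmf slot_pmf slot_pmf) (\<lambda>z. weight \<sigma> e x J 1 (Suc n) (\<theta>(n := z)))
        = 0 * ?W 0 \<theta> + (1 - ?s) * ?W 1 \<theta> + 0 * ?W 2 \<theta>" for \<theta>
      unfolding weight_Suc if_not_P[OF False] two[of "\<lambda>A B. if A \<and> \<not> B then 0 else ?W 1 \<theta>"]
      by (simp add: field_simps)
    have E2: "measure_pmf.expectation (pair_pmf slot_pmf slot_pmf) (\<lambda>z. weight \<sigma> e x J 2 (Suc n) (\<theta>(n := z)))
        = ?s * ?W 0 \<theta> + 0 * ?W 1 \<theta> + (1 - ?s) * ?W 2 \<theta>" for \<theta>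
      unfolding weight_Suc if_not_P[OF False] two[of "\<lambda>A B. if A \<and> \<not> B then ?W 0 \<theta> else ?W 2 \<theta>"]
      by (simp add: field_simps)
    have S0: "E 0 (Suc n) = (1 - ?s) * E 0 n + ?s * E 1 n + ?s * E 2 n"
      unfolding ES E0 by (rule lin)
    have S1: "E 1 (Suc n) = 0 * E 0 n + (1 - ?s) * E 1 n + 0 * E 2 n"
      unfolding ES E1 by (rule lin)
    have S2: "E 2 (Suc n) = ?s * E 0 n + 0 * E 1 n + (1 - ?s) * E 2 n"
      unfolding ES E2 by (rule lin)
    show ?thesis
      using False unfolding evolve.simps Suc[symmetric] S0 S1 S2 by (simp add: Let_def algebra_simps)
  qed
qed

section \<open>The algorithm for a given slot allocation\<close>

text \<open>\<open>touch y\<close> and \<open>skip y\<close> are linear, so a random initial role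
  amounts to starting in the mean of the two initial states.\<close>

lemma evolve_mix:
  "evolve y J (1/2, 0, 1/2) n =
     (let (u, v, z) = evolve y J (1, 0, 0) n; (u', v', z') = evolve y J (0, 0, 1) n
      in ((u + u') / 2, (v + v') / 2, (z + z') / 2))"
proof (induction n)
  case (Suc n)
  obtain u v z where 1: "evolve y J (1, 0, 0) n = (u, v, z)" by (metis prod_cases3)
  obtain u' v' z' where 2: "evolve y J (0, 0, 1) n = (u', v', z')" by (metis prod_cases3)
  show ?case using Suc unfolding evolve.simps 1 2 by (simp add: Let_def field_simps)
qed simp

lemma mass_evolve_mix:
  "mass (evolve y J (1/2, 0, 1/2) n) = (mass (evolve y J (1, 0, 0) n) + mass (evolve y J (0, 0, 1) n)) / 2"
  unfolding evolve_mix
  by (cases "evolve y J (1, 0, 0) n"; cases "evolve y J (0, 0, 1) n") (simp add: field_simps)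

type_synonym seed = "bool \<times> (nat \<times> nat) \<times> bool"

text \<open>
  The first bit of a seed chooses the common initial role of all vertices; only that of round \<open>0\<close> is
  ever read. The remaining components are the two slots and the coin of the round.
\<close>

definition seed_pmf :: "seed pmf" where
  "seed_pmf = pair_pmf coin_pmf (pair_pmf (pair_pmf slot_pmf slot_pmf) coin_pmf)"

definition pick :: "(nat \<Rightarrow> nat \<Rightarrow> 'x) \<Rightarrow> (nat \<Rightarrow> seed) \<Rightarrow> nat \<Rightarrow> 'x" where
  "pick \<sigma> f = select (fstslot \<sigma> (\<lambda>j. fst (snd (f j)))) (sndslot \<sigma> (\<lambda>j. fst (snd (f j))))
                (fst (f 0)) (\<lambda>j. snd (snd (f j)))"

lemma finite_seed_pmf [simp]: "finite (set_pmf seed_pmf)"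
  by (simp add: seed_pmf_def)

text \<open>The coins are averaged first (\<open>prob_never_selected\<close>), then the slot draws
  (\<open>expectation_weight\<close>), and last the initial bit
  (\<open>mass_evolve_mix\<close>).\<close>

lemma prob_pick_avoids:
  assumes "n > 0"
  shows "measure_pmf.prob (Pi_pmf {..<n} d (\<lambda>_. seed_pmf)) {f. \<forall>j<n. j \<in> J \<longrightarrow> pick \<sigma> f j \<noteq> x}
         \<le> mass (evolve (\<lambda>k. share (\<sigma> k) x) J (1/2, 0, 1/2) n)"
proof -
  obtain d1 d2 d3 where d: "d = (d1, d2, d3)" by (metis prod_cases3)
  define PE where "PE = Pi_pmf {..<n} d1 (\<lambda>_. coin_pmf)"
  define PT where "PT = Pi_pmf {..<n} d2 (\<lambda>_. pair_pmf slot_pmf slot_pmf)"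
  define PC where "PC = Pi_pmf {..<n} d3 (\<lambda>_. coin_pmf)"
  have fin [simp]: "finite (set_pmf PE)" "finite (set_pmf PT)" "finite (set_pmf PC)"
    unfolding PE_def PT_def PC_def by (intro finite_set_Pi_pmf; simp)+
  let ?a = "\<lambda>\<theta>. fstslot \<sigma> \<theta>" and ?b = "\<lambda>\<theta>. sndslot \<sigma> \<theta>"
  let ?A = "\<lambda>e \<theta>. {c. \<forall>j<n. j \<in> J \<longrightarrow> select (?a \<theta>) (?b \<theta>) e c j \<noteq> x}"
  define m where "m e = mass (evolve (\<lambda>k. share (\<sigma> k) x) J (if e then (1, 0, 0) else (0, 0, 1)) n)" for e
  have P: "Pi_pmf {..<n} d (\<lambda>_. seed_pmf) =
      map_pmf (\<lambda>(e, g) j. (e j, g j)) (pair_pmf PE (map_pmf (\<lambda>(\<theta>, c) j. (\<theta> j, c j)) (pair_pmf PT PC)))"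
    unfolding d seed_pmf_def Pi_pmf_pair PE_def PT_def PC_def ..
  have avg: "measure_pmf.expectation PT (\<lambda>\<theta>. \<Prod>k<n. miss (?a \<theta>) (?b \<theta>) e x J k) = m e" for e
  proof -
    have sp: "(\<Prod>k<n. miss (?a \<theta>) (?b \<theta>) e x J k)
      = weight \<sigma> e x J 0 n \<theta> + weight \<sigma> e x J 1 n \<theta> + weight \<sigma> e x J 2 n \<theta>" for \<theta>
      using kind_le[of J "phase (?a \<theta>) (?b \<theta>) e n x"] by (auto simp: weight_def)
    have int: "integrable PT F" for F :: "_ \<Rightarrow> real"
      by (intro integrable_measure_pmf_finite) simp
    have "measure_pmf.expectation PT (\<lambda>\<theta>. \<Prod>k<n. miss (?a \<theta>) (?b \<theta>) e x J k)
      = mass (measure_pmf.expectation PT (weight \<sigma> e x J 0 n), measure_pmf.expectation PT (weight \<sigma> e x J 1 n),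
          measure_pmf.expectation PT (weight \<sigma> e x J 2 n))"
      unfolding sp by (simp add: int)
    then show ?thesis
      unfolding PT_def expectation_weight m_def .
  qed
  have "measure_pmf.prob (Pi_pmf {..<n} d (\<lambda>_. seed_pmf)) {f. \<forall>j<n. j \<in> J \<longrightarrow> pick \<sigma> f j \<noteq> x}
      = measure_pmf.expectation (Pi_pmf {..<n} d (\<lambda>_. seed_pmf)) (indicator {f. \<forall>j<n. j \<in> J \<longrightarrow> pick \<sigma> f j \<noteq> x})"
    by simp
  also have "\<dots> = measure_pmf.expectation PE (\<lambda>e. measure_pmf.expectation PT (\<lambda>\<theta>. measure_pmf.expectation PC (\<lambda>c.
      indicator (?A (e 0) \<theta>) c)))"
    unfolding P indicator_def by (simp add: expectation_pair_pmf pick_def case_prod_unfold)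
  also have "\<dots> \<le> measure_pmf.expectation PE (\<lambda>e. m (e 0))"
  proof (intro integral_mono integrable_measure_pmf_finite fin)
    fix e
    have "measure_pmf.expectation PT (\<lambda>\<theta>. measure_pmf.expectation PC (indicator (?A (e 0) \<theta>)))
       \<le> measure_pmf.expectation PT (\<lambda>\<theta>. \<Prod>k<n. miss (?a \<theta>) (?b \<theta>) (e 0) x J k)"
      using prob_never_selected[where N = n and d = d3 and x = x]
      by (intro integral_mono integrable_measure_pmf_finite fin) (simp add: PC_def)
    then show "measure_pmf.expectation PT (\<lambda>\<theta>. measure_pmf.expectation PC (indicator (?A (e 0) \<theta>))) \<le> m (e 0)"
      unfolding avg .
  qed
  also have "\<dots> = measure_pmf.expectation (map_pmf (\<lambda>e. e 0) PE) m"
    by simp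
  \<comment> \<open>Since \<open>n > 0\<close>, the value at round 0 is a fair bit and not the
    default \<open>d1\<close>.\<close>
  also have "\<dots> = (m True + m False) / 2"
    using assms unfolding PE_def by (subst Pi_pmf_component) (auto simp: integral_pmf_of_set UNIV_bool)
  also have "\<dots> = mass (evolve (\<lambda>k. share (\<sigma> k) x) J (1/2, 0, 1/2) n)"
    unfolding m_def mass_evolve_mix by simp
  finally show ?thesis .
qed

lemma pick_cong:
  assumes "\<And>k. k \<le> n \<Longrightarrow> \<sigma> k = \<sigma>' k" "\<And>k. k \<le> n \<Longrightarrow> f k = f' k"
  shows "pick \<sigma> f n = pick \<sigma>' f' n"
proof -
  have "f 0 = f' 0" using assms(2) by simp
  then show ?thesis
    unfolding pick_def using assms by (auto intro!: select_cong simp: fstslot_def sndslot_def)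
qed

lemma pick_in: "pick \<sigma> f n \<in> {\<sigma> n (fst (fst (snd (f n)))), \<sigma> n (snd (fst (snd (f n))))}"
  by (simp add: pick_def select_def fstslot_def sndslot_def)

text \<open>The memory number encodes the seed of a round, so all earlier seeds are recovered from
  the history. Every position from \<open>length h\<close> on is filled with the fresh seed
  \<open>r\<close>, but by \<open>pick_cong\<close> only position \<open>length h\<close> among them
  matters.\<close>

definition slot_alg :: "('l set \<Rightarrow> (nat \<Rightarrow> 'l \<Rightarrow> real) \<Rightarrow> nat \<Rightarrow> nat \<Rightarrow> 'l option) \<Rightarrow> 'l online_alg" where
  "slot_alg S L ws h = map_pmf (\<lambda>r. (to_nat r,
     pick (S L ((!) ws)) (\<lambda>j. if j < length h then from_nat (fst (h ! j)) else r) (length h))) seed_pmf"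

lemma valid_slot_alg:
  assumes "\<And>L v n s. finite L \<Longrightarrow> s < 10 \<Longrightarrow> S L v n s \<in> insert None (Some ` L)"
  shows "valid_online_alg (slot_alg S)"
  unfolding valid_online_alg_def
proof (intro allI impI ballI)
  fix L ws h rd
  assume "finite L" and rd: "rd \<in> set_pmf (slot_alg S L ws h)"
  obtain r d where "rd = (r, d)" by (cases rd)
  with rd obtain x where x: "x \<in> set_pmf seed_pmf"
    "d = pick (S L ((!) ws)) (\<lambda>j. if j < length h then from_nat (fst (h ! j)) else x) (length h)"
    by (auto simp: slot_alg_def)
  from x(1) have "fst (fst (snd x)) < 10" "snd (fst (snd x)) < 10"
    by (auto simp: seed_pmf_def set_pmf_of_set lessThan_empty_iff)
  with pick_in[of "S L ((!) ws)" "\<lambda>j. if j < length h then from_nat (fst (h ! j)) else x" "length h"]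
    assms[OF \<open>finite L\<close>, of "fst (fst (snd x))" "(!) ws" "length h"]
    assms[OF \<open>finite L\<close>, of "snd (fst (snd x))" "(!) ws" "length h"] x(2)
  show "case rd of (r, d) \<Rightarrow> d \<in> insert None (Some ` L)"
    unfolding \<open>rd = (r, d)\<close> by auto
qed

text \<open>The hypothesis says that \<open>S\<close> does not anticipate: slots computed from the
  revealed list agree with those computed from all weights. The run is therefore a function of
  independent seeds.\<close>

lemma run_slot_alg:
  assumes "\<And>v v' n. (\<And>k. k \<le> n \<Longrightarrow> v k = v' k) \<Longrightarrow> S L v n = S L v' n"
  shows "run (slot_alg S) L w n =
    map_pmf (\<lambda>f. map (\<lambda>j. (to_nat (f j), pick (S L (revealed L w)) f j)) [0..<n]) (Pi_pmf {..<n} d (\<lambda>_. seed_pmf))"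
proof (induction n)
  case (Suc n)
  let ?\<sigma> = "S L (revealed L w)"
  let ?h = "\<lambda>f. map (\<lambda>j. (to_nat (f j), pick ?\<sigma> f j)) [0..<n]"
  have S: "S L ((!) (map (revealed L w) [0..<Suc n])) k = ?\<sigma> k" if "k \<le> n" for k
    using that by (intro assms) (simp add: nth_map_upt del: upt_Suc)
  have step: "?h f @ [(to_nat r, pick (S L ((!) (map (revealed L w) [0..<Suc n])))
        (\<lambda>j. if j < length (?h f) then from_nat (fst (?h f ! j)) else r) (length (?h f)))]
      = map (\<lambda>j. (to_nat ((f(n := r)) j), pick ?\<sigma> (f(n := r)) j)) [0..<Suc n]" for f r
  proof -
    have "pick (S L ((!) (map (revealed L w) [0..<Suc n])))
        (\<lambda>j. if j < length (?h f) then from_nat (fst (?h f ! j)) else r) (length (?h f)) = pick ?\<sigma> (f(n := r)) n"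
      unfolding length_map length_upt minus_nat.diff_0 using S by (intro pick_cong) auto
    moreover have "pick ?\<sigma> (f(n := r)) j = pick ?\<sigma> f j" if "j < n" for j
      using that by (intro pick_cong) auto
    ultimately show ?thesis by simp
  qed
  have "run (slot_alg S) L w (Suc n) = bind_pmf (Pi_pmf {..<n} d (\<lambda>_. seed_pmf)) (\<lambda>f. bind_pmf seed_pmf (\<lambda>r.
      return_pmf (map (\<lambda>j. (to_nat ((f(n := r)) j), pick ?\<sigma> (f(n := r)) j)) [0..<Suc n])))"
    unfolding run.simps Suc slot_alg_def map_pmf_def bind_assoc_pmf bind_return_pmf step ..
  also have "\<dots> = map_pmf (\<lambda>f. map (\<lambda>j. (to_nat (f j), pick ?\<sigma> f j)) [0..<Suc n]) (Pi_pmf {..<Suc n} d (\<lambda>_. seed_pmf))"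
    unfolding lessThan_Suc
    by (subst bind_commute_pmf)
       (simp add: Pi_pmf_insert' map_pmf_def bind_assoc_pmf bind_return_pmf del: upt_Suc fun_upd_apply)
  finally show ?case .
qed simp

section \<open>Potential and dual on one vertex\<close>

text \<open>
  The coefficients \<open>c\<close> of \<open>\<Gamma> - dual\<close>, where \<open>\<Gamma> = 0.5086\<close>, solve with a little slack the conditions that make
  \<open>dual\<close> after \<open>touch\<close> plus the marginal decrease of \<open>pot\<close> at least \<open>\<Gamma>\<close> on each of the three unit states;
  \<open>pot\<close> has the coefficients \<open>1 - c\<close>, and \<open>dual start = 0\<close> fixes \<open>\<Gamma>\<close>. The transition \<open>skip y\<close> moves the
  amount \<open>y * (1 - y) * leak\<close> from the value of the current round to \<open>dual\<close>.
\<close>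

fun pot :: "state \<Rightarrow> real" where
  "pot (u, v, z) = 485/1000 * u + 41/100 * v + 4978/10000 * z"

fun dual :: "state \<Rightarrow> real" where
  "dual (u, v, z) = 5086/10000 - 515/1000 * u - 59/100 * v - 5022/10000 * z"

fun leak :: "state \<Rightarrow> real" where
  "leak (u, v, z) = 128/10000 * (u - z) + 75/1000 * v"

text \<open>Invariant of the states: \<open>z \<le> u\<close> makes \<open>leak\<close> nonnegative,
  and \<open>leak \<le> dual\<close> is what dual feasibility requires at thresholds above the
  weight of the current edge.\<close>

fun ok :: "state \<Rightarrow> bool" where
  "ok (u, v, z) \<longleftrightarrow> 0 \<le> v \<and> 0 \<le> z \<and> z \<le> u \<and> leak (u, v, z) \<le> dual (u, v, z)"

definition start :: state where "start = (1/2, 0, 1/2)"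

text \<open>\<open>skip y\<close> fixes \<open>start\<close>, where \<open>dual\<close> and
  \<open>leak\<close> vanish. Thresholds above all weights thus stay at \<open>start\<close>, which
  bounds the support of the integrands below.\<close>

lemma start_simps [simp]: "ok start" "dual start = 0" "leak start = 0" "mass start = 1"
  "touch 0 q = q" "skip y start = start"
  by (simp_all add: start_def Let_def split: prod.splits) (cases q; simp)

text \<open>The coefficients of \<open>pot\<close> and of \<open>\<Gamma> - dual\<close> add up to
  1, and \<open>pot start = 1 - \<Gamma>\<close>. The identity splits the objective into the shares
  of the offline and the online vertices.\<close>

lemma mass_eq: "1 - mass q = dual q + (pot start - pot q)"
  by (cases q) (simp add: start_def)

lemma leak_nonneg: "ok q \<Longrightarrow> 0 \<le> leak q"
  by (cases q) simp

lemma dual_nonneg: "ok q \<Longrightarrow> 0 \<le> dual q"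
  using leak_nonneg[of q] by (cases q) (auto simp del: leak.simps dual.simps)

lemma unit_products:
  fixes y :: real assumes "0 \<le> y" "y \<le> 1"
  shows "0 \<le> y * (1 - y)" "y * (1 - y) \<le> y" "y * (1 - y) \<le> 1/4"
proof -
  show "0 \<le> y * (1 - y)" "y * (1 - y) \<le> y" using assms by (auto intro: mult_left_le)
  have "0 \<le> (y - 1/2)\<^sup>2" by simp
  then show "y * (1 - y) \<le> 1/4" by (simp add: power2_eq_square algebra_simps)
qed

text \<open>The differences are linear in \<open>u\<close>, \<open>v\<close>, \<open>z\<close>, and
  \<open>1 - p \<ge> y\<close> with \<open>r \<le> y / 2\<close> makes all their coefficients
  nonnegative.\<close>

lemma
  assumes "0 \<le> y" "y \<le> 1" "ok q"
  shows ok_touch: "ok (touch y q)" and dual_touch: "dual q \<le> dual (touch y q)"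
proof -
  obtain u v z where q: "q = (u, v, z)" by (cases q)
  define p r where "p = (1 - y) * (1 - y/2)" and "r = y * (1 - y) / 2"
  have r: "0 \<le> r" "r \<le> y / 2" using unit_products[of y] assms by (auto simp: r_def)
  have p: "0 \<le> p" "p \<le> 1 - y" using assms by (auto simp: p_def intro: mult_left_le)
  have uvz: "0 \<le> u" "0 \<le> v" "0 \<le> z" "z \<le> u" using assms by (auto simp: q)
  have t: "touch y q = (p * u + r * z, p * v + r * u, p * z)" by (simp add: q p_def r_def Let_def)
  have "dual (touch y q) - dual q = u * (515/1000 * (1 - p) - 59/100 * r) + v * (59/100 * (1 - p))
      + z * (5022/10000 * (1 - p) - 515/1000 * r)"
    unfolding t unfolding q by (simp add: field_simps)
  moreover have "0 \<le> u * (515/1000 * (1 - p) - 59/100 * r)" "0 \<le> v * (59/100 * (1 - p))"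
      "0 \<le> z * (5022/10000 * (1 - p) - 515/1000 * r)"
    using uvz p r assms by (intro mult_nonneg_nonneg; simp)+
  ultimately show "dual q \<le> dual (touch y q)" by linarith
  have "(dual (touch y q) - leak (touch y q)) - (dual q - leak q) = u * (5278/10000 * (1 - p) - 665/1000 * r)
      + v * (665/1000 * (1 - p)) + z * (4894/10000 * (1 - p) - 5278/10000 * r)"
    unfolding t unfolding q by (simp add: field_simps)
  moreover have "0 \<le> u * (5278/10000 * (1 - p) - 665/1000 * r)" "0 \<le> v * (665/1000 * (1 - p))"
      "0 \<le> z * (4894/10000 * (1 - p) - 5278/10000 * r)"
    using uvz p r assms by (intro mult_nonneg_nonneg; simp)+
  ultimately have "leak (touch y q) \<le> dual (touch y q)" using assms(3) by (simp add: q)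
  moreover have "p * z \<le> p * u" "0 \<le> r * z" "0 \<le> p * v" "0 \<le> r * u" "0 \<le> p * z"
    using uvz p r by (auto intro: mult_left_mono)
  ultimately show "ok (touch y q)" unfolding t by simp
qed

text \<open>\<open>skip\<close> preserves \<open>mass\<close> and raises \<open>dual\<close> and
  \<open>pot\<close> by exactly \<open>s * leak q\<close>. The bound \<open>s \<le> y\<close> gives
  the linear estimate, and \<open>s \<le> 1/4\<close> preserves \<open>z \<le> u\<close>.\<close>

lemma
  assumes "0 \<le> y" "y \<le> 1" "ok q"
  shows ok_skip: "ok (skip y q)" and dual_skip: "dual q \<le> dual (skip y q)"
    and pot_skip: "pot (skip y q) \<le> pot q + y * leak q"
proof -
  obtain u v z where q: "q = (u, v, z)" by (cases q)
  define s where "s = y * (1 - y)"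
  have s: "0 \<le> s" "s \<le> y" "s \<le> 1/4" using unit_products[of y] assms by (auto simp: s_def)
  have uvz: "0 \<le> u" "0 \<le> v" "0 \<le> z" "z \<le> u" using assms by (auto simp: q)
  have t: "skip y q = (u + s * (v + z - u), v - s * v, z + s * (u - z))" by (simp add: q s_def Let_def)
  have "dual (skip y q) - dual q = s * leak q"
    unfolding t unfolding q by (simp add: field_simps)
  then show "dual q \<le> dual (skip y q)" using s leak_nonneg[OF assms(3)] by (smt (verit) mult_nonneg_nonneg)
  have "pot (skip y q) - pot q = s * leak q"
    unfolding t unfolding q by (simp add: field_simps)
  then show "pot (skip y q) \<le> pot q + y * leak q"
    using mult_right_mono[OF s(2) leak_nonneg[OF assms(3)]] by simp
  have "(dual (skip y q) - leak (skip y q)) - (dual q - leak q) = s * (384/10000 * (u - z) + 1372/10000 * v)"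
    unfolding t unfolding q by (simp add: field_simps)
  moreover have "0 \<le> s * (384/10000 * (u - z) + 1372/10000 * v)" using s uvz by simp
  ultimately have "leak (skip y q) \<le> dual (skip y q)" using assms(3) by (simp add: q)
  moreover have "0 \<le> v - s * v" using s uvz by (simp add: mult_left_le_one_le)
  moreover have "0 \<le> z + s * (u - z)" using s uvz by simp
  moreover have "z + s * (u - z) \<le> u + s * (v + z - u)"
  proof -
    have "(u + s * (v + z - u)) - (z + s * (u - z)) = (1 - 2 * s) * (u - z) + s * v" by (simp add: algebra_simps)
    moreover have "0 \<le> (1 - 2 * s) * (u - z)" "0 \<le> s * v" using s uvz by simp_all
    ultimately show ?thesis by linarith
  qed
  ultimately show "ok (skip y q)" unfolding t by simp
qed

text \<open>
  The loss at untouched thresholds is overestimated by the linear \<open>y * leak q\<close>, because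
  \<open>- y * (1 - y) * leak q\<close> would not be concave in \<open>y\<close>.
\<close>

definition level_gain :: "bool \<Rightarrow> real \<Rightarrow> state \<Rightarrow> real" where
  "level_gain b y q = (if b then pot q - pot (touch y q) else - y * leak q)"

lemma level_gain_0 [simp]: "level_gain b 0 q = 0"
  by (simp add: level_gain_def)

lemma level_gain_le:
  assumes "0 \<le> y" "y \<le> 1" "ok q"
  shows "level_gain b y q \<le> pot q - pot ((if b then touch else skip) y q)"
  using pot_skip[OF assms] by (auto simp: level_gain_def)

text \<open>A skipped level is linear in \<open>y\<close>. For a touched one,
  \<open>pot (touch y q)\<close> is quadratic in \<open>y\<close>; the numbers in the calculation
  are its leading coefficients, all positive.\<close>

lemma level_gain_concave:
  assumes "y \<le> y'" "ok q"
  shows "level_gain b (y' + 1/10) q - level_gain b y' q \<le> level_gain b (y + 1/10) q - level_gain b y q"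
proof -
  obtain u v z where q: "q = (u, v, z)" by (cases q)
  have "level_gain True (y + 1/10) q - level_gain True y q - (level_gain True (y' + 1/10) q - level_gain True y' q)
     = (y' - y) / 5 * (375/10000 * u + 205/1000 * v + 64/10000 * z)"
    by (simp add: level_gain_def q Let_def) (simp add: field_simps)
  also have "\<dots> \<ge> 0" using assms by (auto simp: q intro!: mult_nonneg_nonneg)
  finally show ?thesis by (cases b) (simp_all add: level_gain_def algebra_simps)
qed

text \<open>The factor 10 counts the slots: each of them gains at least the next marginal of the
  vertex. In the touched case, the constant terms are the slack that the finite step 1/10 leaves at
  \<open>y = 0\<close>.\<close>

lemma level_dual_feasible:
  assumes "0 \<le> y" "y + 1/10 \<le> 1" "ok q"
  shows "(if b then 5086/10000 else 0) \<le>
    dual ((if b then touch else skip) y q) + 10 * (level_gain b (y + 1/10) q - level_gain b y q)"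
proof (cases b)
  case True
  obtain u v z where q: "q = (u, v, z)" by (cases q)
  have "dual (touch y q) + 10 * (level_gain True (y + 1/10) q - level_gain True y q) - 5086/10000
    = u * (375/100000 + 4025/10000 * y + 375/10000 * (y * y)) + v * (45/10000 + 18/100 * y + 295/1000 * (y * (1 - y)))
      + z * (136/100000 + 483/1000 * y + 64/10000 * (y * y))"
    by (simp add: level_gain_def q Let_def) (simp add: field_simps)
  also have "\<dots> \<ge> 0" using assms by (auto simp: q intro!: mult_nonneg_nonneg add_nonneg_nonneg)
  finally show ?thesis using True by simp
next
  case False
  have "leak q \<le> dual (skip y q)"
    using dual_skip[of y q] assms by (cases q) auto
  then show ?thesis using False by (simp add: level_gain_def algebra_simps)
qed

section \<open>Integration over weight thresholds\<close>

abbreviation levels :: "real measure" where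
  "levels \<equiv> restrict_space lborel {0<..}"

text \<open>A simple function stays measurable under any map of states, and being eventually
  \<open>start\<close> bounds the support; together these give integrability without any regularity
  of the map.\<close>

definition tame :: "(real \<Rightarrow> state) \<Rightarrow> bool" where
  "tame q \<longleftrightarrow> simple_function levels q \<and> (\<exists>B. \<forall>t>B. q t = start) \<and> (\<forall>t. ok (q t))"

lemma simple_function_threshold: "simple_function levels (\<lambda>t. t \<le> w)"
proof -
  have *: "(\<lambda>t. t \<le> w) = (\<lambda>t. if t \<le> w then True else False)" by auto
  show ?thesis
    by (subst *, intro simple_function_If simple_function_const) (auto simp: sets_restrict_space)
qed

lemma tame_integrable:
  fixes F :: "bool \<Rightarrow> state \<Rightarrow> real"
  assumes "tame q" "F False start = 0"
  shows "integrable levels (\<lambda>t. F (t \<le> w) (q t))"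
proof (rule integrable_simple_function)
  from assms obtain B where B: "\<And>t. t > B \<Longrightarrow> q t = start" and q: "simple_function levels q"
    by (auto simp: tame_def)
  show "simple_function levels (\<lambda>t. F (t \<le> w) (q t))"
    by (intro simple_function_compose2[of _ _ _ F] simple_function_threshold q)
  have "{t \<in> space levels. F (t \<le> w) (q t) \<noteq> 0} \<subseteq> {0..max B w}"
    using B assms(2) by (auto simp: space_restrict_space) (metis not_le le_max_iff_disj)
  then have "emeasure levels {t \<in> space levels. F (t \<le> w) (q t) \<noteq> 0} \<le> emeasure lborel {0..max B w}"
    by (subst emeasure_restrict_space) (auto intro!: emeasure_mono)
  also have "\<dots> < \<infinity>" by (simp add: emeasure_lborel_Icc_eq)
  finally show "emeasure levels {t \<in> space levels. F (t \<le> w) (q t) \<noteq> 0} \<noteq> \<infinity>" by simp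
qed

lemma tame_integrable':
  fixes F :: "state \<Rightarrow> real"
  assumes "tame q" "F start = 0"
  shows "integrable levels (\<lambda>t. F (q t))"
  using tame_integrable[of q "\<lambda>_. F"] assms by simp

lemma tame_step:
  assumes "tame q" "0 \<le> y" "y \<le> 1"
  shows "tame (\<lambda>t. (if t \<le> w then touch else skip) y (q t))"
  unfolding tame_def
proof (intro conjI)
  from assms obtain B where B: "\<And>t. t > B \<Longrightarrow> q t = start" and q: "simple_function levels q"
    by (auto simp: tame_def)
  show "simple_function levels (\<lambda>t. (if t \<le> w then touch else skip) y (q t))"
    by (intro simple_function_compose2[of _ _ _ "\<lambda>b. (if b then touch else skip) y"] simple_function_threshold q)
  show "\<exists>B. \<forall>t>B. (if t \<le> w then touch else skip) y (q t) = start"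
    using B by (intro exI[of _ "max B w"]) auto
  show "\<forall>t. ok ((if t \<le> w then touch else skip) y (q t))"
    using assms ok_touch ok_skip by (auto simp: tame_def)
qed

definition gain :: "(real \<Rightarrow> state) \<Rightarrow> real \<Rightarrow> real \<Rightarrow> real" where
  "gain q w y = (LINT t|levels. level_gain (t \<le> w) y (q t))"

lemma integrable_level_gain: "tame q \<Longrightarrow> integrable levels (\<lambda>t. level_gain (t \<le> w) y (q t))"
  by (intro tame_integrable) (auto simp: level_gain_def)

lemma tame_ok: "tame q \<Longrightarrow> ok (q t)"
  by (simp add: tame_def)

lemma gain_0: "gain q w 0 = 0"
  by (simp add: gain_def)

lemma gain_concave:
  assumes "tame q" "y \<le> y'"
  shows "gain q w (y' + 1/10) - gain q w y' \<le> gain q w (y + 1/10) - gain q w y"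
proof -
  have *: "gain q w (y + 1/10) - gain q w y = (LINT t|levels. level_gain (t \<le> w) (y + 1/10) (q t) - level_gain (t \<le> w) y (q t))" for y
    unfolding gain_def by (intro Bochner_Integration.integral_diff[symmetric] integrable_level_gain assms)
  show ?thesis
    unfolding * by (intro integral_mono Bochner_Integration.integrable_diff integrable_level_gain level_gain_concave tame_ok assms)
qed

lemma integral_dual_step_mono:
  assumes "tame q" "0 \<le> y" "y \<le> 1"
  shows "(LINT t|levels. dual (q t)) \<le> (LINT t|levels. dual ((if t \<le> w then touch else skip) y (q t)))"
  using assms tame_ok[OF assms(1)] dual_touch dual_skip
  by (intro integral_mono tame_integrable' tame_step) auto

lemma integral_pot_step:
  assumes "tame q" "0 \<le> y" "y \<le> 1"
  shows "(LINT t|levels. pot start - pot (q t)) + gain q w y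
     \<le> (LINT t|levels. pot start - pot ((if t \<le> w then touch else skip) y (q t)))"
proof -
  have int: "integrable levels (\<lambda>t. pot start - pot (q t))" if "tame q" for q
    using tame_integrable'[OF that, of "\<lambda>q. pot start - pot q"] by simp
  have "(LINT t|levels. pot start - pot (q t)) + gain q w y
      = (LINT t|levels. (pot start - pot (q t)) + level_gain (t \<le> w) y (q t))"
    unfolding gain_def by (intro Bochner_Integration.integral_add[symmetric] int integrable_level_gain assms)
  also have "\<dots> \<le> (LINT t|levels. pot start - pot ((if t \<le> w then touch else skip) y (q t)))"
    using level_gain_le[OF assms(2,3) tame_ok[OF assms(1)]]
    by (intro integral_mono Bochner_Integration.integrable_add int tame_step integrable_level_gain assms) 
       (smt (verit))
  finally show ?thesis .
qed

lemma integral_threshold: "0 \<le> w \<Longrightarrow> (LINT t|levels. (if t \<le> w then c else 0)) = c * w" for c :: real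
proof -
  assume "0 \<le> w"
  have "(LINT t|levels. (if t \<le> w then c else 0)) = (LINT t|lborel. indicator {0<..} t *\<^sub>R (if t \<le> w then c else 0))"
    by (rule integral_restrict_space) simp
  also have "\<dots> = (LINT t|lborel. c * indicator {0<..w} t)"
    by (intro Bochner_Integration.integral_cong) (auto simp: indicator_def)
  also have "\<dots> = c * w" using \<open>0 \<le> w\<close> by simp
  finally show ?thesis .
qed

lemma dual_feasible:
  assumes "tame q" "0 \<le> y" "y + 1/10 \<le> 1" "0 \<le> w"
  shows "5086/10000 * w \<le> (LINT t|levels. dual ((if t \<le> w then touch else skip) y (q t)))
     + 10 * (gain q w (y + 1/10) - gain q w y)"
proof -
  let ?q' = "\<lambda>t. (if t \<le> w then touch else skip) y (q t)"
  have d: "integrable levels (\<lambda>t. dual (?q' t))"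
    using assms by (intro tame_integrable' tame_step) auto
  have g: "gain q w (y + 1/10) - gain q w y = (LINT t|levels. level_gain (t \<le> w) (y + 1/10) (q t) - level_gain (t \<le> w) y (q t))"
    unfolding gain_def by (intro Bochner_Integration.integral_diff[symmetric] integrable_level_gain assms)
  have i: "integrable levels (\<lambda>t. 10 * (level_gain (t \<le> w) (y + 1/10) (q t) - level_gain (t \<le> w) y (q t)))"
    by (intro integrable_mult_right Bochner_Integration.integrable_diff integrable_level_gain assms)
  have "5086/10000 * w = (LINT t|levels. (if t \<le> w then 5086/10000 else 0))"
    using integral_threshold[OF assms(4), of "5086/10000"] by simp
  also have "\<dots> \<le> (LINT t|levels. dual (?q' t) + 10 * (level_gain (t \<le> w) (y + 1/10) (q t) - level_gain (t \<le> w) y (q t)))"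
  proof (intro integral_mono Bochner_Integration.integrable_add d i)
    show "integrable levels (\<lambda>t. if t \<le> w then 5086/10000 else (0 :: real))"
      using tame_integrable[OF assms(1), of "\<lambda>b q. if b then 5086/10000 else 0"] by simp
    fix t
    show "(if t \<le> w then 5086/10000 else 0) \<le> dual (?q' t)
       + 10 * (level_gain (t \<le> w) (y + 1/10) (q t) - level_gain (t \<le> w) y (q t))"
      using level_dual_feasible[OF assms(2,3) tame_ok[OF assms(1)], of "t \<le> w"] by simp
  qed
  also have "\<dots> = (LINT t|levels. dual (?q' t)) + 10 * (gain q w (y + 1/10) - gain q w y)"
    unfolding g by (simp only: Bochner_Integration.integral_add[OF d i] integral_mult_right_zero)
  finally show ?thesis .
qed

text \<open>Treats a vertex that fills all ten slots and has no further marginal: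
  \<open>touch 1\<close> sends every state to zero, where \<open>dual\<close> is \<Gamma>.\<close>

lemma dual_feasible_full:
  assumes "tame q" "0 \<le> w"
  shows "5086/10000 * w \<le> (LINT t|levels. dual ((if t \<le> w then touch else skip) 1 (q t)))"
proof -
  have "5086/10000 * w = (LINT t|levels. (if t \<le> w then 5086/10000 else 0))"
    using integral_threshold[OF assms(2), of "5086/10000"] by simp
  also have "\<dots> \<le> (LINT t|levels. dual ((if t \<le> w then touch else skip) 1 (q t)))"
  proof (intro integral_mono)
    show "integrable levels (\<lambda>t. if t \<le> w then 5086/10000 else (0 :: real))"
      using tame_integrable[OF assms(1), of "\<lambda>b q. if b then 5086/10000 else 0"] by simp
    show "integrable levels (\<lambda>t. dual ((if t \<le> w then touch else skip) 1 (q t)))"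
      using assms by (intro tame_integrable' tame_step) auto
    fix t
    have "dual (touch 1 (q t)) = 5086/10000" by (cases "q t") simp
    moreover have "0 \<le> dual (skip 1 (q t))"
      using tame_ok[OF assms(1)] by (intro dual_nonneg ok_skip) auto
    ultimately show "(if t \<le> w then 5086/10000 else 0) \<le> dual ((if t \<le> w then touch else skip) 1 (q t))"
      by simp
  qed
  finally show ?thesis .
qed

section \<open>Greedy allocation and competitive ratio\<close>

definition marginal :: "('l \<Rightarrow> real \<Rightarrow> real) \<Rightarrow> 'l option list \<Rightarrow> 'l option \<Rightarrow> real" where
  "marginal g xs x = (case x of None \<Rightarrow> 0
     | Some i \<Rightarrow> g i (count_list xs x / 10 + 1/10) - g i (count_list xs x / 10))"

definition best_slot :: "'l set \<Rightarrow> ('l \<Rightarrow> real \<Rightarrow> real) \<Rightarrow> 'l option list \<Rightarrow> 'l option" where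
  "best_slot L g xs = (SOME x. x \<in> insert None (Some ` L) \<and>
     (\<forall>x'\<in>insert None (Some ` L). marginal g xs x' \<le> marginal g xs x))"

primrec greedy :: "'l set \<Rightarrow> ('l \<Rightarrow> real \<Rightarrow> real) \<Rightarrow> nat \<Rightarrow> 'l option list" where
  "greedy L g 0 = []"
| "greedy L g (Suc s) = greedy L g s @ [best_slot L g (greedy L g s)]"

lemma best_slot:
  assumes "finite L"
  shows "best_slot L g xs \<in> insert None (Some ` L)"
    and "x \<in> insert None (Some ` L) \<Longrightarrow> marginal g xs x \<le> marginal g xs (best_slot L g xs)"
proof -
  let ?S = "insert None (Some ` L)"
  have "Max (marginal g xs ` ?S) \<in> marginal g xs ` ?S"
    using assms by (intro Max_in) auto
  then obtain x where x: "Max (marginal g xs ` ?S) = marginal g xs x" "x \<in> ?S" by (elim imageE)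
  have "marginal g xs x' \<le> marginal g xs x" if "x' \<in> ?S" for x'
    unfolding x(1)[symmetric] using assms that by (intro Max_ge finite_imageI imageI) auto
  with x(2) have "x \<in> ?S \<and> (\<forall>x'\<in>?S. marginal g xs x' \<le> marginal g xs x)" by blast
  from someI[of "\<lambda>x. x \<in> ?S \<and> (\<forall>x'\<in>?S. marginal g xs x' \<le> marginal g xs x)", OF this]
  show "best_slot L g xs \<in> ?S" "x \<in> ?S \<Longrightarrow> marginal g xs x \<le> marginal g xs (best_slot L g xs)" for x
    unfolding best_slot_def by blast+
qed

lemma length_greedy [simp]: "length (greedy L g s) = s"
  by (induction s) auto

lemma set_greedy: "finite L \<Longrightarrow> set (greedy L g s) \<subseteq> insert None (Some ` L)"
  using best_slot(1)[of L g] by (induction s) auto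

lemma count_greedy_mono: "s \<le> s' \<Longrightarrow> count_list (greedy L g s) x \<le> count_list (greedy L g s') x"
  by (induction s' rule: dec_induct) auto

lemma count_list_le_length: "count_list xs x \<le> length xs"
  by (induction xs) auto

lemma share_nth:
  assumes "length xs = 10"
  shows "share ((!) xs) x = count_list xs x / 10"
proof -
  have "{s. s < 10 \<and> xs ! s = x} = {s. s < length xs \<and> x = xs ! s}" using assms by auto
  then show ?thesis
    by (simp only: share_def count_list_eq_length_filter length_filter_conv_card)
qed

lemma sum_gain_append:
  assumes "finite L" "x \<in> insert None (Some ` L)"
  shows "(\<Sum>i\<in>L. g i (count_list (xs @ [x]) (Some i) / 10))
       = (\<Sum>i\<in>L. g i (count_list xs (Some i) / 10)) + marginal g xs x"
proof (cases x)
  case None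
  then show ?thesis by (simp add: marginal_def)
next
  case (Some k)
  with assms have "k \<in> L" by auto
  have "(\<Sum>i\<in>L. g i (count_list (xs @ [x]) (Some i) / 10))
    = (\<Sum>i\<in>L. g i (count_list xs (Some i) / 10) + (if i = k then marginal g xs x else 0))"
    using Some by (intro sum.cong) (auto simp: marginal_def add_divide_distrib)
  then show ?thesis using assms \<open>k \<in> L\<close> by (simp add: sum.distrib)
qed

text \<open>\<open>Some i\<close> was on offer at each of the \<open>s\<close> steps, and by
  concavity its marginal was then at least the one at its final share; every step gains at least
  that much. Offering \<open>None\<close>, with marginal 0, keeps each step nonnegative.\<close>

lemma greedy_value:
  assumes L: "finite L" and zero: "\<And>i. g i 0 = 0"
    and conc: "\<And>i y y'. i \<in> L \<Longrightarrow> y \<le> y' \<Longrightarrow> g i (y' + 1/10) - g i y' \<le> g i (y + 1/10) - g i y"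
  defines "V \<equiv> \<lambda>s. \<Sum>i\<in>L. g i (count_list (greedy L g s) (Some i) / 10)"
  shows "0 \<le> V s"
    and "i \<in> L \<Longrightarrow> y = count_list (greedy L g s) (Some i) / 10 \<Longrightarrow> real s * (g i (y + 1/10) - g i y) \<le> V s"
proof -
  have V_Suc: "V (Suc s) = V s + marginal g (greedy L g s) (best_slot L g (greedy L g s))" for s
    unfolding V_def greedy.simps by (intro sum_gain_append L best_slot)
  have V_0: "V 0 = 0" by (simp add: V_def zero)
  have inc: "marginal g (greedy L g s) x \<le> V (Suc s) - V s" if "x \<in> insert None (Some ` L)" for s x
    using best_slot(2)[OF L that] by (simp add: V_Suc)
  have "V s \<le> V (Suc s)" for s
    using inc[of None s] by (simp add: marginal_def)
  then show "0 \<le> V s" using V_0 lift_Suc_mono_le[of V 0 s] by simp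
  assume i: "i \<in> L" and y: "y = count_list (greedy L g s) (Some i) / 10"
  have "real s' * (g i (y + 1/10) - g i y) \<le> V s'" if "s' \<le> s" for s'
    using that
  proof (induction s')
    case (Suc s')
    let ?y = "count_list (greedy L g s') (Some i) / 10"
    have "?y \<le> y" using count_greedy_mono[of s' s] Suc.prems by (simp add: y divide_right_mono)
    then have "g i (y + 1/10) - g i y \<le> marginal g (greedy L g s') (Some i)"
      using conc[OF i] by (simp add: marginal_def)
    also have "\<dots> \<le> V (Suc s') - V s'" using i by (intro inc) simp
    finally show ?case using Suc by (simp add: algebra_simps)
  qed (simp add: V_0)
  then show "real s * (g i (y + 1/10) - g i y) \<le> V s" by simp
qed

section \<open>Dual fitting along the run\<close>

primrec states :: "'l set \<Rightarrow> (nat \<Rightarrow> 'l \<Rightarrow> real) \<Rightarrow> nat \<Rightarrow> 'l \<Rightarrow> real \<Rightarrow> state" where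
  "states L v 0 = (\<lambda>i t. start)"
| "states L v (Suc n) = (\<lambda>i t. (if t \<le> v n i then touch else skip)
     (share ((!) (greedy L (\<lambda>i. gain (states L v n i) (v n i)) 10)) (Some i)) (states L v n i t))"

definition slots :: "'l set \<Rightarrow> (nat \<Rightarrow> 'l \<Rightarrow> real) \<Rightarrow> nat \<Rightarrow> nat \<Rightarrow> 'l option" where
  "slots L v n = (!) (greedy L (\<lambda>i. gain (states L v n i) (v n i)) 10)"

lemma states_cong: "(\<And>k. k < n \<Longrightarrow> v k = v' k) \<Longrightarrow> states L v n = states L v' n"
  by (induction n) simp_all

lemma slots_cong: "(\<And>k. k \<le> n \<Longrightarrow> v k = v' k) \<Longrightarrow> slots L v n = slots L v' n"
  unfolding slots_def using states_cong[of n v v' L] by simp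

lemma slots_in: "finite L \<Longrightarrow> s < 10 \<Longrightarrow> slots L v n s \<in> insert None (Some ` L)"
  unfolding slots_def using set_greedy by (metis length_greedy nth_mem subsetD)

lemma states_evolve:
  "states L v n i t = evolve (\<lambda>k. share (slots L v k) (Some i)) {k. t \<le> v k i} (1/2, 0, 1/2) n"
  by (induction n) (simp_all add: slots_def start_def)

lemma tame_states: "tame (states L v n i)"
proof (induction n)
  case 0
  show ?case by (simp add: tame_def)
next
  case (Suc n)
  show ?case
    using tame_step[OF Suc, of "share (slots L v n) (Some i)" "v n i"] share_bounds[of "slots L v n" "Some i"]
    by (simp add: slots_def)
qed

text \<open>Weak duality: \<open>\<alpha> i + \<beta> j\<close> covers \<Gamma> times each edge
  weight, and a matching uses each vertex at most once. The gains of the rounds telescope against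
  \<open>pot\<close>, and \<open>mass_eq\<close> turns the total into the right-hand side.\<close>

lemma matching_weight_le:
  assumes L: "finite L" and v: "\<And>i j. i \<in> L \<Longrightarrow> j < n \<Longrightarrow> 0 \<le> v j i" and M: "bipartite_matching L n M"
  shows "5086/10000 * (\<Sum>(i, j)\<in>M. v j i) \<le> (\<Sum>i\<in>L. LINT t|levels. 1 - mass (states L v n i t))"
proof -
  let ?q = "states L v"
  let ?y = "\<lambda>j i. share (slots L v j) (Some i)"
  define \<alpha> where "\<alpha> i = (LINT t|levels. dual (?q n i t))" for i
  define \<beta> where "\<beta> j = (\<Sum>i\<in>L. gain (?q j i) (v j i) (?y j i))" for j
  have y: "?y j i = count_list (greedy L (\<lambda>i. gain (?q j i) (v j i)) 10) (Some i) / 10" for j i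
    by (simp add: slots_def share_nth)
  have step: "?q (Suc j) i = (\<lambda>t. (if t \<le> v j i then touch else skip) (?y j i) (?q j i t))" for i j
    by (simp add: slots_def)
  have \<beta>_nonneg: "0 \<le> \<beta> j" for j
    unfolding \<beta>_def y using L by (intro greedy_value(1) gain_0 gain_concave tame_states)
  have \<beta>_ge: "10 * (gain (?q j i) (v j i) (?y j i + 1/10) - gain (?q j i) (v j i) (?y j i)) \<le> \<beta> j" if "i \<in> L" for i j
    using greedy_value(2)[OF L gain_0 gain_concave[OF tame_states] that y[of j i]]
    by (simp add: \<beta>_def y)
  \<comment> \<open>An edge is covered right after its own round; monotonicity carries this over to
    the final states in \<open>\<alpha>\<close>.\<close>
  have dual_mono: "(LINT t|levels. dual (?q k i t)) \<le> \<alpha> i" if "k \<le> n" for i k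
    unfolding \<alpha>_def using that
  proof (induction n rule: dec_induct)
    case (step m)
    then show ?case
      using integral_dual_step_mono[OF tame_states, of "?y m i" L v m i "v m i"] share_bounds[of "slots L v m" "Some i"]
      by (simp add: slots_def)
  qed simp
  have \<alpha>_nonneg: "0 \<le> \<alpha> i" for i
    unfolding \<alpha>_def by (intro Bochner_Integration.integral_nonneg dual_nonneg tame_ok tame_states)
  have feasible: "5086/10000 * v j i \<le> \<alpha> i + \<beta> j" if "i \<in> L" "j < n" for i j
  proof -
    have \<alpha>: "(LINT t|levels. dual ((if t \<le> v j i then touch else skip) (?y j i) (?q j i t))) \<le> \<alpha> i"
      using dual_mono[of "Suc j" i] that unfolding step by simp
    show ?thesis
    proof (cases "?y j i + 1/10 \<le> 1")
      case True
      then show ?thesis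
        using dual_feasible[OF tame_states, of "?y j i" "v j i" L v j i] \<alpha> \<beta>_ge[OF that(1), of j] v[OF that]
          share_bounds(1)[of "slots L v j" "Some i"] by linarith
    next
      case False
      \<comment> \<open>Shares are multiples of 1/10, so one without room for a further slot equals
        1.\<close>
      then have "\<not> real (count_list (greedy L (\<lambda>i. gain (?q j i) (v j i)) 10) (Some i)) \<le> 9"
        unfolding y by simp
      moreover have "count_list (greedy L (\<lambda>i. gain (?q j i) (v j i)) 10) (Some i) \<le> 10"
        using count_list_le_length by (metis length_greedy)
      ultimately have "?y j i = 1" unfolding y by simp
      then show ?thesis
        using dual_feasible_full[OF tame_states, of "v j i" L v j i] \<alpha> \<beta>_nonneg[of j] v[OF that] by simp
    qed
  qed
  have sum_pot: "(\<Sum>j<k. gain (?q j i) (v j i) (?y j i)) \<le> (LINT t|levels. pot start - pot (?q k i t))" for i k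
  proof (induction k)
    case (Suc k)
    then show ?case
      using integral_pot_step[OF tame_states, of "?y k i" L v k i "v k i"] share_bounds[of "slots L v k" "Some i"]
      unfolding step by simp
  qed simp
  have "\<alpha> i + (\<Sum>j<n. gain (?q j i) (v j i) (?y j i)) \<le> (LINT t|levels. 1 - mass (?q n i t))" for i
  proof -
    have "(LINT t|levels. 1 - mass (?q n i t)) = \<alpha> i + (LINT t|levels. pot start - pot (?q n i t))"
      unfolding mass_eq \<alpha>_def
      using tame_integrable'[OF tame_states[of L v n i], of dual]
        tame_integrable'[OF tame_states[of L v n i], of "\<lambda>q. pot start - pot q"]
      by (intro Bochner_Integration.integral_add) simp_all
    then show ?thesis using sum_pot[of i n] by simp
  qed
  then have total: "(\<Sum>i\<in>L. \<alpha> i) + (\<Sum>j<n. \<beta> j) \<le> (\<Sum>i\<in>L. LINT t|levels. 1 - mass (?q n i t))"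
    unfolding \<beta>_def sum.swap[of _ L] by (simp add: sum_mono flip: sum.distrib)
  have M_sub: "M \<subseteq> L \<times> {..<n}" and inj: "inj_on fst M" "inj_on snd M"
    using M by (auto simp: bipartite_matching_def inj_on_def)
  have "5086/10000 * (\<Sum>(i, j)\<in>M. v j i) \<le> (\<Sum>e\<in>M. \<alpha> (fst e) + \<beta> (snd e))"
    unfolding sum_distrib_left using M_sub feasible by (intro sum_mono) (auto simp: case_prod_unfold)
  also have "\<dots> = (\<Sum>i\<in>fst ` M. \<alpha> i) + (\<Sum>j\<in>snd ` M. \<beta> j)"
    by (simp add: sum.distrib sum.reindex inj)
  also have "\<dots> \<le> (\<Sum>i\<in>L. \<alpha> i) + (\<Sum>j<n. \<beta> j)"
    using M_sub L \<alpha>_nonneg \<beta>_nonneg by (intro add_mono sum_mono2) auto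
  finally show ?thesis using total by simp
qed

section \<open>Offline optimum and expected objective\<close>

lemma offline_opt_attained:
  assumes "finite L"
  obtains M where "bipartite_matching L m M" "offline_opt L m w = (\<Sum>(i, j)\<in>M. w i j)"
proof -
  let ?F = "{M. bipartite_matching L m M}"
  have "?F \<subseteq> Pow (L \<times> {..<m})" by (auto simp: bipartite_matching_def)
  then have "finite ?F" using assms by (auto intro: finite_subset)
  moreover have "{} \<in> ?F" by (simp add: bipartite_matching_def)
  ultimately have "offline_opt L m w \<in> (\<lambda>M. \<Sum>(i, j)\<in>M. w i j) ` ?F"
    unfolding offline_opt_def by (intro Max_in) auto
  with that show ?thesis by auto
qed

text \<open>Layer-cake formula: thresholds in \<open>levels\<close> are positive, so the inserted 0
  meets none of them.\<close>

lemma Max_eq_integral_levels: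
  fixes w :: "nat \<Rightarrow> real"
  assumes "finite X"
  shows "Max (insert 0 (w ` X)) = (LINT t|levels. of_bool (\<exists>j\<in>X. t \<le> w j))"
proof -
  let ?m = "Max (insert 0 (w ` X))"
  have "of_bool (\<exists>j\<in>X. t \<le> w j) = (if t \<le> ?m then 1 else (0::real))" if "t \<in> space levels" for t
    using that assms by (auto simp: space_restrict_space Max_ge_iff)
  then have "(LINT t|levels. of_bool (\<exists>j\<in>X. t \<le> w j)) = (LINT t|levels. (if t \<le> ?m then 1 else (0::real)))"
    by (intro Bochner_Integration.integral_cong) auto
  also have "\<dots> = ?m" using assms by (subst integral_threshold) auto
  finally show ?thesis by simp
qed

lemma integrable_of_bool_threshold:
  assumes "finite X"
  shows "integrable levels (\<lambda>t. of_bool (\<exists>j\<in>X. t \<le> w j) :: real)"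
proof -
  let ?m = "Max (insert 0 (w ` X))"
  have eq: "of_bool (\<exists>j\<in>X. t \<le> w j) = (if t \<le> ?m then 1 else (0::real))" if "t \<in> space levels" for t
    using that assms by (auto simp: space_restrict_space Max_ge_iff)
  have "tame (\<lambda>_. start)" by (simp add: tame_def)
  from tame_integrable[OF this, of "\<lambda>b _. if b then 1 else 0" ?m]
  show ?thesis using eq by (subst Bochner_Integration.integrable_cong[OF refl eq]) simp_all
qed

lemma objective_eq:
  assumes "finite L" "length h = m"
  shows "objective L m w h = (\<Sum>i\<in>L. LINT t|levels. of_bool (\<exists>j<m. snd (h ! j) = Some i \<and> t \<le> w i j))"
  unfolding objective_def by (intro sum.cong refl) (subst Max_eq_integral_levels, auto intro!: arg_cong[where f = "integral\<^sup>L levels"] simp: fun_eq_iff)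

text \<open>With finite support, the expectation is a finite sum.\<close>

lemma expectation_integral_commute:
  fixes F :: "'a \<Rightarrow> real \<Rightarrow> real"
  assumes "finite (set_pmf p)" "\<And>x. x \<in> set_pmf p \<Longrightarrow> integrable M (F x)"
  shows "measure_pmf.expectation p (\<lambda>x. LINT t|M. F x t) = (LINT t|M. measure_pmf.expectation p (\<lambda>x. F x t))"
    and "integrable M (\<lambda>t. measure_pmf.expectation p (\<lambda>x. F x t))"
proof -
  have *: "measure_pmf.expectation p G = (\<Sum>x\<in>set_pmf p. G x * pmf p x)" for G :: "'a \<Rightarrow> real"
    using assms(1) by (intro integral_measure_pmf_real) auto
  show "measure_pmf.expectation p (\<lambda>x. LINT t|M. F x t) = (LINT t|M. measure_pmf.expectation p (\<lambda>x. F x t))"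
    unfolding * using assms by (subst Bochner_Integration.integral_sum) auto
  show "integrable M (\<lambda>t. measure_pmf.expectation p (\<lambda>x. F x t))"
    unfolding * using assms by (intro Bochner_Integration.integrable_sum) auto
qed

lemma competitive_slot_alg: "competitive 0.5086 (slot_alg slots :: 'l online_alg)"
  unfolding competitive_def
proof (intro allI impI)
  fix L :: "'l set" and m w
  assume inst: "obm_instance L m w"
  then have L: "finite L" and w: "\<And>i j. i \<in> L \<Longrightarrow> j < m \<Longrightarrow> 0 \<le> w i j"
    by (auto simp: obm_instance_def)
  define v where "v = revealed L w"
  have v: "v j i = w i j" if "i \<in> L" for i j using that by (simp add: v_def revealed_def)
  obtain M where M: "bipartite_matching L m M" "offline_opt L m w = (\<Sum>(i, j)\<in>M. w i j)"
    using offline_opt_attained[OF L] .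
  have wv: "(\<Sum>(i, j)\<in>M. w i j) = (\<Sum>(i, j)\<in>M. v j i)"
    using M(1) by (intro sum.cong) (auto simp: bipartite_matching_def v)
  have "5086/10000 * (\<Sum>(i, j)\<in>M. v j i) \<le> (\<Sum>i\<in>L. LINT t|levels. 1 - mass (states L v m i t))"
    by (rule matching_weight_le[OF L _ M(1)]) (simp add: v w)
  then have opt: "0.5086 * offline_opt L m w \<le> (\<Sum>i\<in>L. LINT t|levels. 1 - mass (states L v m i t))"
    unfolding M(2) wv by simp
  define d :: seed where "d = undefined"
  let ?P = "Pi_pmf {..<m} d (\<lambda>_. seed_pmf)"
  let ?hit = "\<lambda>f i t. \<exists>j\<in>{j. j < m \<and> pick (slots L v) f j = Some i}. t \<le> w i j"
  have fin: "finite (set_pmf ?P)" by (intro finite_set_Pi_pmf) auto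
  have hit_int: "integrable levels (\<lambda>t. of_bool (?hit f i t) :: real)" for f i
    by (rule integrable_of_bool_threshold) simp
  have hit_ge: "1 - mass (states L v m i t) \<le> measure_pmf.expectation ?P (\<lambda>f. of_bool (?hit f i t))" if i: "i \<in> L" for i t
  \<comment> \<open>Without rounds the state is \<open>start\<close>, of mass 1, and the bound reads
    0; \<open>prob_pick_avoids\<close> needs a round 0.\<close>
  proof (cases "m = 0")
    case True
    then show ?thesis by simp
  next
    case False
    let ?A = "{f. \<forall>j<m. j \<in> {k. t \<le> v k i} \<longrightarrow> pick (slots L v) f j \<noteq> Some i}"
    have "measure_pmf.expectation ?P (\<lambda>f. of_bool (?hit f i t)) = measure_pmf.expectation ?P (\<lambda>f. 1 - indicator ?A f)"
      using v[OF i] by (intro Bochner_Integration.integral_cong) (auto simp: indicator_def)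
    also have "\<dots> = 1 - measure_pmf.prob ?P ?A"
      by (subst Bochner_Integration.integral_diff) (simp_all add: integrable_measure_pmf_finite fin)
    finally show ?thesis
      using prob_pick_avoids[of m d "{k. t \<le> v k i}" "slots L v" "Some i"] False
      unfolding states_evolve by simp
  qed
  let ?h = "\<lambda>f. map (\<lambda>j. (to_nat (f j), pick (slots L v) f j)) [0..<m]"
  have "run (slot_alg slots) L w m = map_pmf ?h ?P"
    unfolding v_def by (intro run_slot_alg slots_cong)
  then have "measure_pmf.expectation (run (slot_alg slots) L w m) (objective L m w)
    = measure_pmf.expectation ?P (\<lambda>f. objective L m w (?h f))"
    by simp
  also have "\<dots> = measure_pmf.expectation ?P (\<lambda>f. \<Sum>i\<in>L. LINT t|levels. of_bool (?hit f i t))"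
  proof (intro Bochner_Integration.integral_cong refl)
    fix f
    have "(\<exists>j<m. snd (?h f ! j) = Some i \<and> t \<le> w i j) = ?hit f i t" for i t by auto
    then show "objective L m w (?h f) = (\<Sum>i\<in>L. LINT t|levels. of_bool (?hit f i t))"
      by (subst objective_eq[OF L]) simp_all
  qed
  also have "\<dots> = (\<Sum>i\<in>L. measure_pmf.expectation ?P (\<lambda>f. LINT t|levels. of_bool (?hit f i t)))"
    by (intro Bochner_Integration.integral_sum integrable_measure_pmf_finite fin)
  also have "\<dots> = (\<Sum>i\<in>L. LINT t|levels. measure_pmf.expectation ?P (\<lambda>f. of_bool (?hit f i t)))"
    by (intro sum.cong refl expectation_integral_commute(1)) (rule fin hit_int)+
  also have "\<dots> \<ge> (\<Sum>i\<in>L. LINT t|levels. 1 - mass (states L v m i t))"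
  proof (intro sum_mono integral_mono hit_ge)
    fix i
    show "integrable levels (\<lambda>t. 1 - mass (states L v m i t))"
      using tame_integrable'[OF tame_states[of L v m i], of "\<lambda>q. 1 - mass q"] by simp
    show "integrable levels (\<lambda>t. measure_pmf.expectation ?P (\<lambda>f. of_bool (?hit f i t)) :: real)"
      by (intro expectation_integral_commute(2)) (rule fin hit_int)+
  qed
  finally show "0.5086 * offline_opt L m w \<le> measure_pmf.expectation (run (slot_alg slots) L w m) (objective L m w)"
    by (rule order_trans[OF opt])
qed

theorem theorem1:
  shows "\<exists>A :: 'l online_alg. valid_online_alg A \<and> competitive 0.5086 A"
proof (intro exI conjI)
  show "valid_online_alg (slot_alg slots :: 'l online_alg)"
    by (intro valid_slot_alg slots_in)
  show "competitive 0.5086 (slot_alg slots :: 'l online_alg)"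
    by (rule competitive_slot_alg)
qed

end
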